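(* Let $X_1,X_2$ be Polish spaces, $a_i:X_i\to[0,+\infty]$ Borel measurable and not identically $+\infty$ ($i=1,2$), and $c:X_1\times X_2\to[0,+\infty]$ lower semicontinuous with $c(x_1,x_2)\le a_1(x_1)+a_2(x_2)$ for all $(x_1,x_2)$. Let $F\subset\mathcal P_{a_1\oplus a_2}(X_1\times X_2)$ be a totally $\mathsf C$-cyclically monotone subset. Then: 1. Every $\pi\in F$ is $\mathsf C$-optimal, i.e. $\pi\in\Gamma_{o,c}(\mathrm{pr}^1_\sharp\pi,\mathrm{pr}^2_\sharp\pi)$. 2. The set $(\mathrm{pr}^1_\sharp,\mathrm{pr}^2_\sharp)F\subset\mathcal P_{a_1}(X_1)\times\mathcal P_{a_2}(X_2)$ is $\mathsf C$-cyclically monotone. 3. There exists a $\mathsf C$-concave function $\phi_1:\mathcal P_{a_1}(X_1)\to[-\infty,+\infty)$ such that $F\subseteq\partial^+_{\mathsf t,\mathsf C}\phi_1$. In particular, for every $\mathsf C$-cyclically monotone $\mathfrak F\subset\mathcal P_{a_1}(X_1)\times\mathcal P_{a_2}(X_2)$, the set $$\overline F:=\big\{\pi\in\mathcal P_{a_1\oplus a_2}(X_1\times X_2)\ :\ \pi\in\Gamma_{o,c}(\mathrm{pr}^1_\sharp\pi,\mathrm{pr}^2_\sharp\pi),\ (\mathrm{pr}^1_\sharp\pi,\mathrm{pr}^2_\sharp\pi)\in\mathfrak F\big\}$$ is totally $\mathsf C$-cyclically monotone.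
   Context: $\mathcal P(Y)$ is the set of Borel probability measures on a Polish space $Y$; $\Gamma(\mu_1,\mu_2)$ is the set of couplings; $\mathrm{pr}^i$ are projections. $\mathsf C(\mu_1,\mu_2):=\min_{\pi\in\Gamma(\mu_1,\mu_2)}\int c\,d\pi$, and $\Gamma_{o,c}(\mu_1,\mu_2)$ is the set of minimizers. $\mathcal P_{a_i}(X_i):=\{\mu_i\in\mathcal P(X_i):\int a_i\,d\mu_i<+\infty\}$, $\mathcal P_{a_1\oplus a_2}(X_1\times X_2):=\{\pi\in\mathcal P(X_1\times X_2):\mathrm{pr}^i_\sharp\pi\in\mathcal P_{a_i}(X_i),\,i=1,2\}$. $\mathsf C$ is finite on $\mathcal P_{a_1}(X_1)\times\mathcal P_{a_2}(X_2)$ and the following notions refer to $\mathsf C$ restricted to this product. $\mathfrak F\subset\mathcal P_{a_1}(X_1)\times\mathcal P_{a_2}(X_2)$ is $\mathsf C$-cyclically monotone if for all $k\ge1$, all permutations $\sigma$ of $\{1,\dots,k\}$ and all $(\mu_{1,i},\mu_{2,i})\in\mathfrak F$, $i\le k$: $\sum_i\mathsf C(\mu_{1,i},\mu_{2,\sigma(i)})\ge\sum_i\mathsf C(\mu_{1,i},\mu_{2,i})$. $\phi_1:\mathcal P_{a_1}(X_1)\to[-\infty,+\infty)$ is $\mathsf C$-concave if it is not identically $-\infty$ and there is $A\subset\mathcal P_{a_2}(X_2)\times\mathbb R$ with $\phi_1(\mu_1)=\inf_{(\mu_2,\alpha)\in A}\mathsf C(\mu_1,\mu_2)-\alpha$.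 Total $\mathsf C$-superdifferential: $\partial^+_{\mathsf t,\mathsf C}\phi_1$ is the set of $\pi\in\mathcal P_{a_1\oplus a_2}(X_1\times X_2)$ such that for all $\theta\in\mathcal P(X_1\times X_2\times X_1)$ with $(\mathrm{pr}^1,\mathrm{pr}^2)_\sharp\theta=\pi$ and $\mathrm{pr}^3_\sharp\theta\in\mathcal P_{a_1}(X_1)$, $$\int\big(c(x_1,x_2)-c(x_1',x_2)\big)\,d\theta(x_1,x_2,x_1')\le\phi_1(\mathrm{pr}^1_\sharp\theta)-\phi_1(\mathrm{pr}^3_\sharp\theta).$$ Total $\mathsf C$-cyclical monotonicity: $F\subset\mathcal P_{a_1\oplus a_2}(X_1\times X_2)$ is totally $\mathsf C$-cyclically monotone if for all $N\ge1$, all $\theta\in\mathcal P((X_1\times X_2)^N)$ whose marginal $\mathrm{pr}^n_\sharp\theta$ on the $n$-th factor $X_1\times X_2$ belongs to $F$ for every $n\le N$, and all permutations $\sigma$ of $\{1,\dots,N\}$, $$\int\sum_{i=1}^Nc(x_{1,i},x_{2,i})\,d\theta\le\int\sum_{i=1}^Nc(x_{1,i},x_{2,\sigma(i)})\,d\theta .$$ *)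

theory Defs
  imports "HOL-Probability.Probability"
begin

definition lower_semicont :: "('a::topological_space \<Rightarrow> ennreal) \<Rightarrow> bool" where
  "lower_semicont f \<longleftrightarrow> (\<forall>t. open {x. t < f x})"

abbreviation borel_probs :: "'a::topological_space measure set" where
  "borel_probs \<equiv> space (prob_algebra borel)"

lemma borel_probs_iff: "\<mu> \<in> borel_probs \<longleftrightarrow> prob_space \<mu> \<and> sets \<mu> = sets borel"
  by (auto simp: space_prob_algebra)

definition couplings ::
  "'a::topological_space measure \<Rightarrow> 'b::topological_space measure \<Rightarrow> ('a \<times> 'b) measure set" where
  "couplings \<mu>1 \<mu>2 =
     {\<pi> \<in> borel_probs. distr \<pi> borel fst = \<mu>1 \<and> distr \<pi> borel snd = \<mu>2}"

(* An infimum, which is a minimum when the spaces are Polish and c is lower semicontinuous. *)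
definition OT_cost ::
  "('a::topological_space \<times> 'b::topological_space \<Rightarrow> ennreal) \<Rightarrow> 'a measure \<Rightarrow> 'b measure \<Rightarrow> ennreal" where
  "OT_cost c \<mu>1 \<mu>2 = (INF \<pi>\<in>couplings \<mu>1 \<mu>2. \<integral>\<^sup>+z. c z \<partial>\<pi>)"

definition optimal_couplings ::
  "('a::topological_space \<times> 'b::topological_space \<Rightarrow> ennreal) \<Rightarrow> 'a measure \<Rightarrow> 'b measure
     \<Rightarrow> ('a \<times> 'b) measure set" where
  "optimal_couplings c \<mu>1 \<mu>2 =
     {\<pi> \<in> couplings \<mu>1 \<mu>2. \<forall>\<pi>'\<in>couplings \<mu>1 \<mu>2. (\<integral>\<^sup>+z. c z \<partial>\<pi>) \<le> (\<integral>\<^sup>+z. c z \<partial>\<pi>')}"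

definition probs_fin :: "('a::topological_space \<Rightarrow> ennreal) \<Rightarrow> 'a measure set" where
  "probs_fin a = {\<mu> \<in> borel_probs. (\<integral>\<^sup>+x. a x \<partial>\<mu>) < \<infinity>}"

definition probs_fin_prod ::
  "('a::topological_space \<Rightarrow> ennreal) \<Rightarrow> ('b::topological_space \<Rightarrow> ennreal) \<Rightarrow> ('a \<times> 'b) measure set" where
  "probs_fin_prod a1 a2 =
     {\<pi> \<in> borel_probs. distr \<pi> borel fst \<in> probs_fin a1 \<and> distr \<pi> borel snd \<in> probs_fin a2}"

definition cyclically_monotone ::
  "('a::topological_space \<Rightarrow> ennreal) \<Rightarrow> ('b::topological_space \<Rightarrow> ennreal) \<Rightarrow> ('a \<times> 'b \<Rightarrow> ennreal)
     \<Rightarrow> ('a measure \<times> 'b measure) set \<Rightarrow> bool" where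
  "cyclically_monotone a1 a2 c G \<longleftrightarrow>
     G \<subseteq> probs_fin a1 \<times> probs_fin a2 \<and>
     (\<forall>k::nat. \<forall>\<sigma> \<mu>1 \<mu>2. k \<ge> 1 \<longrightarrow> \<sigma> permutes {1..k} \<longrightarrow> (\<forall>i\<in>{1..k}. (\<mu>1 i, \<mu>2 i) \<in> G) \<longrightarrow>
        (\<Sum>i=1..k. OT_cost c (\<mu>1 i) (\<mu>2 (\<sigma> i))) \<ge> (\<Sum>i=1..k. OT_cost c (\<mu>1 i) (\<mu>2 i)))"

(* Functions on probs_fin a1 are represented by total functions; their values outside
   probs_fin a1 are irrelevant here and in total_superdiff. *)
definition OT_concave ::
  "('a::topological_space \<Rightarrow> ennreal) \<Rightarrow> ('b::topological_space \<Rightarrow> ennreal) \<Rightarrow> ('a \<times> 'b \<Rightarrow> ennreal)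
     \<Rightarrow> ('a measure \<Rightarrow> ereal) \<Rightarrow> bool" where
  "OT_concave a1 a2 c \<phi> \<longleftrightarrow>
     (\<forall>\<mu>1\<in>probs_fin a1. \<phi> \<mu>1 < \<infinity>) \<and>
     (\<exists>\<mu>1\<in>probs_fin a1. \<phi> \<mu>1 \<noteq> -\<infinity>) \<and>
     (\<exists>A \<subseteq> probs_fin a2 \<times> (UNIV :: real set). \<forall>\<mu>1\<in>probs_fin a1.
        \<phi> \<mu>1 = (INF (\<mu>2, \<alpha>)\<in>A. enn2ereal (OT_cost c \<mu>1 \<mu>2) - ereal \<alpha>))"

(* Under c(x1, x2) \<le> a1 x1 + a2 x2 both cost terms have finite integral with respect to \<theta>, so they
   are finite almost everywhere, enn2real changes them on a null set only, and the Bochner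
   integral is that of an integrable function.
   The ereal value (-\<infinity>) - (-\<infinity>) = \<infinity> on the right-hand side is harmless: if \<phi> is not identically
   -\<infinity> on probs_fin a1, a \<theta> whose third marginal has finite \<phi> excludes every \<pi> whose first
   marginal has \<phi> = -\<infinity>. *)
definition total_superdiff ::
  "('a::topological_space \<Rightarrow> ennreal) \<Rightarrow> ('b::topological_space \<Rightarrow> ennreal) \<Rightarrow> ('a \<times> 'b \<Rightarrow> ennreal)
     \<Rightarrow> ('a measure \<Rightarrow> ereal) \<Rightarrow> ('a \<times> 'b) measure set" where
  "total_superdiff a1 a2 c \<phi> =
     {\<pi> \<in> probs_fin_prod a1 a2. \<forall>\<theta> \<in> (borel_probs :: ('a \<times> 'b \<times> 'a) measure set).
        distr \<theta> borel (\<lambda>(x1, x2, x1'). (x1, x2)) = \<pi> \<longrightarrow>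
        distr \<theta> borel (\<lambda>(x1, x2, x1'). x1') \<in> probs_fin a1 \<longrightarrow>
        ereal (\<integral>(x1, x2, x1'). enn2real (c (x1, x2)) - enn2real (c (x1', x2)) \<partial>\<theta>)
          \<le> \<phi> (distr \<theta> borel (\<lambda>(x1, x2, x1'). x1)) - \<phi> (distr \<theta> borel (\<lambda>(x1, x2, x1'). x1'))}"

(* (X1 \<times> X2)^N is the product measurable space over the index set {1..N}; for second countable
   spaces its product sigma-algebra is the Borel one. *)
definition totally_cyclically_monotone ::
  "('a::topological_space \<Rightarrow> ennreal) \<Rightarrow> ('b::topological_space \<Rightarrow> ennreal) \<Rightarrow> ('a \<times> 'b \<Rightarrow> ennreal)
     \<Rightarrow> ('a \<times> 'b) measure set \<Rightarrow> bool" where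
  "totally_cyclically_monotone a1 a2 c F \<longleftrightarrow>
     F \<subseteq> probs_fin_prod a1 a2 \<and>
     (\<forall>N::nat. \<forall>\<theta> \<in> space (prob_algebra (Pi\<^sub>M {1..N} (\<lambda>_. borel :: ('a \<times> 'b) measure))). \<forall>\<sigma>.
        N \<ge> 1 \<longrightarrow> (\<forall>n\<in>{1..N}. distr \<theta> borel (\<lambda>x. x n) \<in> F) \<longrightarrow> \<sigma> permutes {1..N} \<longrightarrow>
        (\<integral>\<^sup>+x. (\<Sum>i=1..N. c (fst (x i), snd (x i))) \<partial>\<theta>)
          \<le> (\<integral>\<^sup>+x. (\<Sum>i=1..N. c (fst (x i), snd (x (\<sigma> i)))) \<partial>\<theta>))"

end

theory Submission
  imports Defs "HOL-Combinatorics.Cycles"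
begin

text \<open>Let \<open>\<pi>\<^sub>i\<close> belong to \<open>F\<close> and let \<open>\<gamma>\<^sub>i\<close> couple the first marginal of \<open>\<pi>\<^sub>i\<close> with the second
  marginal of \<open>\<pi>\<^bsub>\<sigma>(i)\<^esub>\<close>. Disintegration yields a Markov chain with \<open>n\<close> links that alternates between the
  \<open>\<pi>\<close>'s and the \<open>\<gamma>\<close>'s along the inverse of \<open>\<sigma>\<close>. Total cyclic monotonicity applied to its law compares \<open>n\<close>
  costs of \<open>\<pi>\<close>'s with \<open>n - 1\<close> costs of \<open>\<gamma>\<close>'s and one closing term, bounded through \<open>a1\<close> and \<open>a2\<close>.
  Summing over the starting index and letting \<open>n \<rightarrow> \<infinity>\<close> gives \<open>\<Sum>\<^sub>i \<integral>c d\<pi>\<^sub>i \<le> \<Sum>\<^sub>i \<integral>c d\<gamma>\<^sub>i\<close>, that is,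
  optimality (\<open>\<sigma> = id\<close>) and cyclic monotonicity of the marginals. Rockafellar's construction for the cost
  between measures then produces the potential, and optimality of \<open>\<pi>\<close> turns its superdifferential
  inequality into the total one. The converse needs no gluing: the coordinates of \<open>\<theta>\<close> are
  admissible couplings.\<close>

section \<open>Disintegration on Polish spaces\<close>

text \<open>Base 3 with digits 0 and 1 only avoids the ambiguity of binary expansions: the tail
  beyond place \<open>m\<close> amounts to at most half a unit of that place, so it never carries,
  and every digit is recovered from \<open>r\<close> by a Borel expression.\<close>

lemma ternary_digit:
  fixes b :: "nat \<Rightarrow> bool"
  defines "r \<equiv> (\<Sum>j. of_bool (b j) * (1/3)^Suc j :: real)"
  shows "0 \<le> r" "r \<le> 1" "\<lfloor>3^Suc m * r\<rfloor> mod 3 = (of_bool (b m) :: int)"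
proof -
  define t where "t j = (of_bool (b j) * (1/3)^Suc j :: real)" for j
  have geom: "(\<lambda>j. (1/3 :: real)^Suc j) sums (1/2)"
    using sums_mult[OF geometric_sums[of "1/3::real"], of "1/3"] by simp
  have t: "0 \<le> t j" "t j \<le> (1/3)^Suc j" for j
    by (auto simp: t_def of_bool_def)
  have st: "summable t"
    by (rule summable_comparison_test'[OF sums_summable[OF geom]]) (use t in auto)
  have r: "r = suminf t" unfolding r_def t_def ..
  show "0 \<le> r" unfolding r by (intro suminf_nonneg st t)
  have "r \<le> 1/2"
    unfolding r using suminf_le[OF t(2) st sums_summable[OF geom]] sums_unique[OF geom] by simp
  then show "r \<le> 1" by simp
  define s where "s = (\<Sum>j. t (j + Suc m))"
  have st': "summable (\<lambda>j. t (j + Suc m))" using st by (simp only: summable_iff_shift)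
  have s0: "0 \<le> s" unfolding s_def by (intro suminf_nonneg st' t)
  have geom': "(\<lambda>j. (1/3 :: real)^Suc (j + Suc m)) sums ((1/3)^Suc m * (1/2))"
    using sums_mult[OF geom, of "(1/3)^Suc m"] by (simp add: power_add mult_ac)
  have "s \<le> (1/3)^Suc m * (1/2)"
    unfolding s_def sums_unique[OF geom'] by (rule suminf_le[OF t(2) st' sums_summable[OF geom']])
  then have s1: "3^Suc m * s < 1"
    by (simp add: field_simps)
  \<comment> \<open>\<open>3^Suc m * r\<close> splits into the integer
    \<open>S + of_bool (b m)\<close> and a remainder in [0, 1). All exponents \<open>m-j\<close> in
    \<open>S\<close> are positive, so \<open>S\<close> vanishes modulo 3 and only digit
    \<open>m\<close> survives.\<close>
  define S where "S = (\<Sum>j<m. of_bool (b j) * 3^(m-j) :: int)"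
  have "r = (\<Sum>j<Suc m. t j) + s"
    unfolding r s_def by (subst suminf_split_initial_segment[OF st, of "Suc m"]) simp
  then have "3^Suc m * r = (\<Sum>j<Suc m. 3^Suc m * t j) + 3^Suc m * s"
    by (simp add: distrib_left sum_distrib_left)
  also have "(\<Sum>j<Suc m. 3^Suc m * t j) = (\<Sum>j<Suc m. of_int (of_bool (b j) * 3^(m-j)))"
  proof (rule sum.cong)
    fix j assume "j \<in> {..<Suc m}"
    then have "3^Suc m * (1/3 :: real)^Suc j = 3^(m-j)"
      by (simp add: power_diff power_one_over)
    then show "3^Suc m * t j = of_int (of_bool (b j) * 3^(m-j))"
      by (cases "b j") (simp_all add: t_def)
  qed simp
  also have "\<dots> = of_int (S + of_bool (b m))"
    by (simp add: S_def)
  finally have "\<lfloor>3^Suc m * r\<rfloor> = S + of_bool (b m)"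
    using s0 s1 by (intro floor_unique) auto
  moreover have "3 dvd S"
    unfolding S_def by (intro dvd_sum dvd_mult) auto
  ultimately show "\<lfloor>3^Suc m * r\<rfloor> mod 3 = (of_bool (b m) :: int)"
    by (auto simp: of_bool_def elim!: dvdE)
qed

text \<open>The ternary digits of \<open>f x\<close> record which balls of a countable base contain \<open>x\<close>; \<open>g\<close> reads
  off a sequence of centres converging to \<open>x\<close>.\<close>

lemma polish_real_embedding:
  obtains f :: "'b::polish_space \<Rightarrow> real" and g :: "real \<Rightarrow> 'b"
  where "f \<in> borel_measurable borel" "g \<in> borel_measurable borel"
    "\<And>x. g (f x) = x" "\<And>x. 0 \<le> f x" "\<And>x. f x \<le> 1"
proof -
  obtain D :: "'b set" where D: "countable D" "\<And>X. open X \<Longrightarrow> X \<noteq> {} \<Longrightarrow> \<exists>d\<in>D. d \<in> X"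
    using countable_dense_setE by blast
  have "D \<noteq> {}" using D(2)[of UNIV] by auto
  define d where "d = from_nat_into D"
  have d: "\<exists>k. dist (d k) x < e" if "0 < e" for x e
  proof -
    obtain y where "y \<in> D" "y \<in> ball x e" using D(2)[of "ball x e"] \<open>0 < e\<close> by auto
    then show ?thesis
      using from_nat_into_surj[OF D(1)] by (auto simp: d_def dist_commute)
  qed
  define b where "b x m = (case prod_decode m of (n, k) \<Rightarrow> dist (d k) x < (1/2)^n)" for x m
  define f where "f x = (\<Sum>j. of_bool (b x j) * (1/3)^Suc j :: real)" for x
  \<comment> \<open>At \<open>r = f x\<close> this is the first centre within \<open>(1/2)^n\<close>
    of \<open>x\<close>, found from the digits alone.\<close>
  define u where "u n r = d (LEAST k. \<lfloor>3^Suc (prod_encode (n, k)) * r\<rfloor> mod 3 = (1::int))" for n and r :: real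
  \<comment> \<open>Off the range of \<open>f\<close> the centres need not converge. The default
    \<open>d 0\<close> keeps \<open>g\<close> an everywhere pointwise limit of Borel
    functions.\<close>
  define g where "g r = (if Cauchy (\<lambda>n. u n r) then lim (\<lambda>n. u n r) else d 0)" for r
  have f_meas: "f \<in> borel_measurable borel"
    unfolding f_def b_def of_bool_def case_prod_beta by measurable
  have u_meas[measurable]: "u n \<in> borel_measurable borel" for n
    unfolding u_def by measurable
  have "g \<in> borel_measurable borel"
  proof (rule borel_measurable_LIMSEQ_metric)
    show "(\<lambda>r. if Cauchy (\<lambda>n. u n r) then u n r else d 0) \<in> borel_measurable borel" for n
      by measurable
    show "(\<lambda>n. if Cauchy (\<lambda>n. u n r) then u n r else d 0) \<longlonglongrightarrow> g r" for r
      by (auto simp: g_def Cauchy_convergent_iff convergent_LIMSEQ_iff)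
  qed
  moreover have "g (f x) = x" for x
  proof -
    have "dist (u n (f x)) x < (1/2)^n" for n
    proof -
      have "\<lfloor>3^Suc (prod_encode (n, k)) * f x\<rfloor> mod 3 = (1::int) \<longleftrightarrow> dist (d k) x < (1/2)^n" for k
        unfolding f_def ternary_digit by (simp add: b_def)
      then have "u n (f x) = d (LEAST k. dist (d k) x < (1/2)^n)"
        unfolding u_def by presburger
      then show ?thesis
        using LeastI_ex[OF d[of "(1/2)^n" x]] by simp
    qed
    then have "(\<lambda>n. u n (f x)) \<longlonglongrightarrow> x"
      by (intro metric_tendsto_imp_tendsto[OF LIMSEQ_power_zero[of "1/2::real"]] always_eventually)
        (auto intro: less_imp_le)
    then show ?thesis
      by (auto simp: g_def LIMSEQ_imp_Cauchy limI)
  qed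
  ultimately show thesis
    using f_meas ternary_digit(1,2) that[of f g] by (auto simp: f_def)
qed

section \<open>Conditional distributions\<close>

text \<open>If \<open>g < f\<close> held on a set of positive measure, integrating over that set
  would contradict \<open>le\<close>; finiteness of the integral of \<open>g\<close> makes this
  inequality of integrals strict.\<close>

lemma AE_le_of_set_integral_le:
  fixes f g :: "'a \<Rightarrow> ennreal"
  assumes [measurable]: "f \<in> borel_measurable M" "g \<in> borel_measurable M"
    and fin: "(\<integral>\<^sup>+x. g x \<partial>M) < \<infinity>"
    and le: "\<And>A. A \<in> sets M \<Longrightarrow> (\<integral>\<^sup>+x. f x * indicator A x \<partial>M) \<le> (\<integral>\<^sup>+x. g x * indicator A x \<partial>M)"
  shows "AE x in M. f x \<le> g x"
proof (rule ccontr)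
  assume *: "\<not> (AE x in M. f x \<le> g x)"
  define A where "A = {x \<in> space M. g x < f x}"
  have A[measurable]: "A \<in> sets M" unfolding A_def by measurable
  have "(\<integral>\<^sup>+x. g x * indicator A x \<partial>M) \<le> (\<integral>\<^sup>+x. g x \<partial>M)"
    by (intro nn_integral_mono) (auto simp: indicator_def)
  then have "(\<integral>\<^sup>+x. g x * indicator A x \<partial>M) < (\<integral>\<^sup>+x. f x * indicator A x \<partial>M)"
  proof (intro nn_integral_less)
    show "AE x in M. g x * indicator A x \<le> f x * indicator A x"
      by (auto simp: A_def indicator_def)
    show "\<not> (AE x in M. f x * indicator A x \<le> g x * indicator A x)"
    proof
      assume "AE x in M. f x * indicator A x \<le> g x * indicator A x"
      with AE_space have "AE x in M. f x \<le> g x"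
        by eventually_elim (metis (mono_tags, lifting) A_def indicator_simps(1) linorder_not_less mem_Collect_eq mult.right_neutral)
      with * show False ..
    qed
  qed (use fin in auto)
  with le[OF A] show False by simp
qed

text \<open>\<open>G\<close> is a version of the conditional probability of
  \<open>snd z \<le> q\<close> given \<open>fst z\<close>, a Radon--Nikodym derivative against the
  first marginal. The support condition permits the choice of a version that equals 0 or 1 at every
  point, not just almost everywhere, when \<open>q\<close> lies outside [0, 1).\<close>

lemma partial_cdf_density:
  fixes \<pi> :: "('a \<times> real) measure" and M :: "'a measure" and q :: real
  assumes \<pi>: "prob_space \<pi>" and sets_\<pi>[measurable_cong]: "sets \<pi> = sets (M \<Otimes>\<^sub>M borel)"
    and supp: "AE z in \<pi>. 0 \<le> snd z \<and> snd z \<le> 1"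
  obtains G :: "'a \<Rightarrow> real" where "G \<in> borel_measurable M"
    "\<And>x. 0 \<le> G x" "\<And>x. G x \<le> 1" "\<And>x. q < 0 \<Longrightarrow> G x = 0" "\<And>x. 1 \<le> q \<Longrightarrow> G x = 1"
    "\<And>A. A \<in> sets M \<Longrightarrow> (\<integral>\<^sup>+x. ennreal (G x) * indicator A x \<partial>distr \<pi> M fst) = emeasure \<pi> (A \<times> {..q})"
proof -
  interpret \<pi>: prob_space \<pi> by fact
  define \<mu> where "\<mu> = distr \<pi> M fst"
  interpret \<mu>: prob_space \<mu> unfolding \<mu>_def by (rule \<pi>.prob_space_distr) measurable
  have sets_\<mu>[measurable_cong, simp]: "sets \<mu> = sets M" by (simp add: \<mu>_def)
  have space_\<pi>: "space \<pi> = space M \<times> UNIV"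
    using sets_eq_imp_space_eq[OF sets_\<pi>] by (simp add: space_pair_measure)
  have \<mu>_eq: "emeasure \<mu> A = emeasure \<pi> (A \<times> UNIV)" if "A \<in> sets M" for A
    using that sets.sets_into_space[OF that] unfolding \<mu>_def
    by (subst emeasure_distr) (auto simp: space_\<pi> intro!: arg_cong[where f="emeasure \<pi>"])
  consider "q < 0" | "1 \<le> q" | "0 \<le> q" "q < 1" by linarith
  then show thesis
  proof cases
    case 1
    have "emeasure \<pi> (A \<times> {..q}) = emeasure \<pi> {}" if [measurable]: "A \<in> sets M" for A
      using supp 1 by (intro emeasure_eq_AE) (auto elim!: eventually_mono)
    with 1 show thesis by (intro that[of "\<lambda>_. 0"]) auto
  next
    case 2
    have "emeasure \<pi> (A \<times> {..q}) = emeasure \<mu> A" if [measurable]: "A \<in> sets M" for A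
      unfolding \<mu>_eq[OF that]
    proof (rule emeasure_eq_AE)
      show "AE z in \<pi>. z \<in> A \<times> {..q} \<longleftrightarrow> z \<in> A \<times> UNIV"
        using supp by eventually_elim (use 2 in auto)
    qed auto
    with 2 show thesis by (intro that[of "\<lambda>_. 1"]) (auto simp: \<mu>_def[symmetric])
  next
    case 3
    \<comment> \<open>The part of \<open>\<pi>\<close> on the half-strip below \<open>q\<close>,
      projected to the first factor. It is dominated by the first marginal, so it has a density that
      is almost everywhere at most 1.\<close>
    define N where "N = distr (density \<pi> (indicator (space M \<times> {..q}))) M fst"
    have [measurable_cong, simp]: "sets N = sets M" by (simp add: N_def)
    have N: "emeasure N A = emeasure \<pi> (A \<times> {..q})" if [measurable]: "A \<in> sets M" for A
    proof -
      have eq: "fst -` A \<inter> space \<pi> = A \<times> UNIV"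
        using sets.sets_into_space[OF that] by (auto simp: space_\<pi>)
      have "emeasure N A = (\<integral>\<^sup>+z. indicator (space M \<times> {..q}) z * indicator (A \<times> UNIV) z \<partial>\<pi>)"
        unfolding N_def by (subst emeasure_distr) (auto simp: emeasure_density eq)
      also have "\<dots> = (\<integral>\<^sup>+z. indicator (A \<times> {..q}) z \<partial>\<pi>)"
        using sets.sets_into_space[OF that] by (intro nn_integral_cong) (auto simp: indicator_def)
      finally show ?thesis by simp
    qed
    have N_le: "emeasure N A \<le> emeasure \<mu> A" if [measurable]: "A \<in> sets M" for A
      unfolding N[OF that] \<mu>_eq[OF that] by (intro emeasure_mono) auto
    have "absolutely_continuous \<mu> N"
      unfolding absolutely_continuous_def
    proof
      fix A assume "A \<in> null_sets \<mu>"
      then have "A \<in> sets M" "emeasure \<mu> A = 0" by auto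
      with N_le[of A] show "A \<in> null_sets N" by (simp add: null_setsI)
    qed
    from \<mu>.Radon_Nikodym[OF this] obtain f where "f \<in> borel_measurable \<mu>" and fN: "density \<mu> f = N"
      by (rule bexE) simp_all
    then have f[measurable]: "f \<in> borel_measurable M" by (simp cong: measurable_cong_sets)
    have int_f: "(\<integral>\<^sup>+x. f x * indicator A x \<partial>\<mu>) = emeasure N A" if "A \<in> sets M" for A
      using that unfolding fN[symmetric] by (subst emeasure_density) auto
    have f1: "AE x in \<mu>. f x \<le> 1"
      by (rule AE_le_of_set_integral_le) (auto simp: int_f N_le \<mu>.emeasure_space_1)
    \<comment> \<open>Truncation at 1 changes the density on a null set only and makes the bound
      hold everywhere.\<close>
    show thesis
    proof (rule that[of "\<lambda>x. enn2real (min 1 (f x))"])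
      show "enn2real (min 1 (f x)) \<le> 1" for x
        by (rule enn2real_leI) auto
      have "(\<integral>\<^sup>+x. ennreal (enn2real (min 1 (f x))) * indicator A x \<partial>\<mu>) = (\<integral>\<^sup>+x. f x * indicator A x \<partial>\<mu>)" for A
      proof (rule nn_integral_cong_AE)
        show "AE x in \<mu>. ennreal (enn2real (min 1 (f x))) * indicator A x = f x * indicator A x"
          using f1
        proof eventually_elim
          case (elim x)
          then have "f x < top" by (rule order_le_less_trans) simp
          with elim show ?case by (simp add: min_absorb2)
        qed
      qed
      then show "(\<integral>\<^sup>+x. ennreal (enn2real (min 1 (f x))) * indicator A x \<partial>distr \<pi> M fst) = emeasure \<pi> (A \<times> {..q})"
        if "A \<in> sets M" for A
        unfolding \<mu>_def[symmetric] using int_f[OF that] N[OF that] by simp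
    qed (use 3 in auto)
  qed
qed

text \<open>The distribution function of the kernel is an infimum of Radon--Nikodym densities over the
  rationals above \<open>t\<close>, hence monotone and right-continuous at every point, without exceptional
  sets; the normalisation of \<open>G q\<close> outside \<open>[0, 1)\<close> settles the limits at infinity.\<close>

lemma disintegration_unit_interval:
  fixes \<pi> :: "('a \<times> real) measure" and M :: "'a measure"
  assumes \<pi>: "prob_space \<pi>" and sets_\<pi>[measurable_cong]: "sets \<pi> = sets (M \<Otimes>\<^sub>M borel)"
    and supp: "AE z in \<pi>. 0 \<le> snd z \<and> snd z \<le> 1"
  obtains \<kappa> where "\<kappa> \<in> M \<rightarrow>\<^sub>M prob_algebra borel"
    "\<pi> = distr \<pi> M fst \<bind> (\<lambda>x. distr (\<kappa> x) (M \<Otimes>\<^sub>M borel) (Pair x))"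
proof -
  interpret \<pi>: prob_space \<pi> by fact
  define \<mu> where "\<mu> = distr \<pi> M fst"
  interpret \<mu>: prob_space \<mu> unfolding \<mu>_def by (rule \<pi>.prob_space_distr) measurable
  have sets_\<mu>[measurable_cong, simp]: "sets \<mu> = sets M" by (simp add: \<mu>_def)
  have space_\<mu>[simp]: "space \<mu> = space M" by (simp add: \<mu>_def)
  have [simp]: "emeasure \<mu> (space M) = 1" using \<mu>.emeasure_space_1 by simp
  have "\<forall>q. \<exists>G :: 'a \<Rightarrow> real. G \<in> borel_measurable M \<and> (\<forall>x. 0 \<le> G x \<and> G x \<le> 1) \<and>
      (q < 0 \<longrightarrow> (\<forall>x. G x = 0)) \<and> (1 \<le> q \<longrightarrow> (\<forall>x. G x = 1)) \<and>
      (\<forall>A\<in>sets M. (\<integral>\<^sup>+x. ennreal (G x) * indicator A x \<partial>\<mu>) = emeasure \<pi> (A \<times> {..q}))"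
    unfolding \<mu>_def by (rule allI, rule partial_cdf_density[OF \<pi> sets_\<pi> supp]) blast
  then obtain G where "\<forall>q. G q \<in> borel_measurable M \<and> (\<forall>x. 0 \<le> G q x \<and> G q x \<le> 1) \<and>
      (q < 0 \<longrightarrow> (\<forall>x. G q x = 0)) \<and> (1 \<le> q \<longrightarrow> (\<forall>x. G q x = 1)) \<and>
      (\<forall>A\<in>sets M. (\<integral>\<^sup>+x. ennreal (G q x) * indicator A x \<partial>\<mu>) = emeasure \<pi> (A \<times> {..q}))"
    by (rule choice[THEN exE])
  then have G[measurable]: "G q \<in> borel_measurable M"
    and G01: "0 \<le> G q x" "G q x \<le> 1"
    and G0: "q < 0 \<Longrightarrow> G q x = 0" and G1: "1 \<le> q \<Longrightarrow> G q x = 1"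
    and int_G: "A \<in> sets M \<Longrightarrow> (\<integral>\<^sup>+x. ennreal (G q x) * indicator A x \<partial>\<mu>) = emeasure \<pi> (A \<times> {..q})"
    for q x A
    by blast+
  \<comment> \<open>For each pair the exceptional set is null; restricted to rationals there are
    countably many pairs, so one null set serves them all.\<close>
  have "AE x in \<mu>. \<forall>q\<in>\<rat>. \<forall>r\<in>\<rat>. q \<le> r \<longrightarrow> G q x \<le> G r x"
  proof (intro AE_ball_countable' countable_rat)
    fix q r :: real
    show "AE x in \<mu>. q \<le> r \<longrightarrow> G q x \<le> G r x"
    proof (cases "q \<le> r")
      case True
      have "AE x in \<mu>. ennreal (G q x) \<le> ennreal (G r x)"
      proof (rule AE_le_of_set_integral_le)
        have "(\<integral>\<^sup>+x. ennreal (G r x) \<partial>\<mu>) \<le> (\<integral>\<^sup>+x. 1 \<partial>\<mu>)"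
          using G01 by (intro nn_integral_mono) auto
        then show "(\<integral>\<^sup>+x. ennreal (G r x) \<partial>\<mu>) < \<infinity>"
          by (auto intro: order_le_less_trans)
        show "(\<integral>\<^sup>+x. ennreal (G q x) * indicator A x \<partial>\<mu>) \<le> (\<integral>\<^sup>+x. ennreal (G r x) * indicator A x \<partial>\<mu>)"
          if "A \<in> sets \<mu>" for A
          using that True by (simp add: int_G) (intro emeasure_mono; auto simp: sets_\<pi>)
      qed measurable
      then show ?thesis using G01 by (auto elim!: eventually_mono)
    qed simp
  qed
  then have mono: "AE x in \<mu>. \<forall>q\<in>\<rat>. \<forall>r\<in>\<rat>. q \<le> r \<longrightarrow> G q x \<le> G r x" .
  define Q where "Q t = {q \<in> \<rat>. t < q}" for t :: real
  \<comment> \<open>The index sets shrink as \<open>t\<close> grows, which makes \<open>H x\<close>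
    monotone even at points where \<open>G\<close> is not monotone in \<open>q\<close>; the strict
    inequality in \<open>Q t\<close> yields right-continuity.\<close>
  define H where "H x t = (INF q\<in>Q t. G q x)" for x t
  have Q_ne: "Q t \<noteq> {}" for t
    using Rats_dense_in_real[of t "t + 1"] by (auto simp: Q_def)
  have Q_countable: "countable (Q t)" for t
    unfolding Q_def by (rule countable_subset[OF _ countable_rat]) auto
  have bdd: "bdd_below ((\<lambda>q. G q x) ` Q t)" for x t
    by (rule bdd_belowI[of _ 0]) (auto simp: G01)
  have H_le: "H x t \<le> G q x" if "q \<in> \<rat>" "t < q" for x t q
    unfolding H_def using that by (intro cINF_lower bdd) (auto simp: Q_def)
  have H0: "0 \<le> H x t" for x t
    unfolding H_def by (intro cINF_greatest Q_ne G01)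
  have H1: "H x t \<le> 1" for x t
  proof -
    obtain q where "q \<in> Q t" using Q_ne by blast
    then have "H x t \<le> G q x" by (intro H_le) (auto simp: Q_def)
    also have "G q x \<le> 1" by (rule G01)
    finally show ?thesis .
  qed
  have H_less: "\<exists>q\<in>\<rat>. t < q \<and> G q x < H x t + e" if "0 < e" for x t e
  proof -
    have "(INF q\<in>Q t. G q x) < H x t + e" using that by (simp add: H_def)
    then show ?thesis
      using cINF_less_iff[OF Q_ne bdd] by (auto simp: Q_def)
  qed
  have H_mono: "H x s \<le> H x t" if "s \<le> t" for x s t
    unfolding H_def using that by (intro cINF_superset_mono Q_ne bdd) (auto simp: Q_def)
  have H_cont: "continuous (at_right t) (H x)" for x t
  proof (subst continuous_at_right_real_increasing[OF H_mono], assumption, intro allI impI)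
    \<comment> \<open>A rational \<open>q\<close> that nearly attains the infimum at
      \<open>t\<close> also lies above the midpoint of \<open>t\<close> and \<open>q\<close>, so it
      bounds \<open>H\<close> there too.\<close>
    fix e :: real assume "0 < e"
    from H_less[OF this, of t x] obtain q where q: "q \<in> \<rat>" "t < q" "G q x < H x t + e" by auto
    have "H x (t + (q - t)/2) \<le> G q x"
      using q by (intro H_le) (auto simp: field_simps)
    with q show "\<exists>d>0. H x (t + d) - H x t < e"
      by (intro exI[of _ "(q - t)/2"]) auto
  qed
  have H_bot: "(H x \<longlongrightarrow> 0) at_bot" for x
  proof (rule tendsto_eventually, subst eventually_at_bot_dense, intro exI allI impI)
    fix t :: real assume "t < 0"
    then obtain q where "q \<in> \<rat>" "t < q" "q < 0" using Rats_dense_in_real by blast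
    with H_le[of q t x] G0[of q x] H0[of x t] show "H x t = 0" by simp
  qed
  have H_top: "(H x \<longlongrightarrow> 1) at_top" for x
  proof (rule tendsto_eventually, subst eventually_at_top_linorder, intro exI allI impI)
    fix t :: real assume "1 \<le> t"
    then have "1 \<le> H x t" unfolding H_def
      by (intro cINF_greatest Q_ne) (auto simp: Q_def G1)
    with H1[of x t] show "H x t = 1" by simp
  qed
  have [measurable]: "(\<lambda>x. H x t) \<in> borel_measurable M" for t
    unfolding H_def by (intro borel_measurable_cINF Q_countable bdd G)
  define \<kappa> where "\<kappa> x = interval_measure (H x)" for x
  have \<kappa>_prob: "prob_space (\<kappa> x)" for x
    using real_distribution_interval_measure[OF H_mono H_cont H_bot H_top]
    by (simp add: \<kappa>_def real_distribution_def)
  have \<kappa>_Iic: "emeasure (\<kappa> x) {..t} = ennreal (H x t)" for x t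
    unfolding \<kappa>_def by (rule emeasure_interval_measure_Iic[OF H_mono H_cont H_bot])
  have sets_atMost: "sets (borel :: real measure) = sigma_sets UNIV (range atMost)"
    by (subst borel_eq_atMost) simp
  have \<kappa>[measurable]: "\<kappa> \<in> M \<rightarrow>\<^sub>M prob_algebra borel"
  proof (rule measurable_prob_algebra_generated[OF sets_atMost])
    show "(\<lambda>x. emeasure (\<kappa> x) A) \<in> borel_measurable M" if "A \<in> range atMost" for A
      using that by (auto simp: \<kappa>_Iic)
  qed (auto simp: Int_stable_def \<kappa>_prob, simp_all add: \<kappa>_def)
  have int_H: "(\<integral>\<^sup>+x. ennreal (H x t) * indicator A x \<partial>\<mu>) = emeasure \<pi> (A \<times> {..t})"
    if A[measurable]: "A \<in> sets M" for A t
  proof -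
    \<comment> \<open>Rationals squeezed between consecutive points
      \<open>t + 1 / real (Suc n)\<close> decrease to \<open>t\<close> while staying strictly above
      it.\<close>
    have "\<exists>q\<in>\<rat>. t + 1 / real (Suc (Suc n)) < q \<and> q < t + 1 / real (Suc n)" for n
      by (rule Rats_dense_in_real) (simp add: field_simps)
    then obtain q where q: "q n \<in> \<rat>" "t + 1 / real (Suc (Suc n)) < q n" "q n < t + 1 / real (Suc n)" for n
      by metis
    have tq: "t < q n" for n
      using q(2)[of n] by (rule less_trans[rotated]) simp
    have "q (Suc n) \<le> q n" for n
      using q(2)[of n] q(3)[of "Suc n"] by simp
    then have dec: "decseq q" by (rule decseq_SucI)
    have q_lim: "q \<longlonglongrightarrow> t"
    proof (rule tendsto_sandwich[of "\<lambda>_. t" _ _ "\<lambda>n. t + 1 / real (Suc n)"])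
      show "(\<lambda>n. t + 1 / real (Suc n)) \<longlonglongrightarrow> t"
        using tendsto_add[OF tendsto_const LIMSEQ_inverse_real_of_nat, of t] by (simp add: inverse_eq_divide)
    qed (use q tq in \<open>auto intro!: always_eventually less_imp_le\<close>)
    have "(\<lambda>n. \<integral>\<^sup>+x. ennreal (G (q n) x) * indicator A x \<partial>\<mu>) \<longlonglongrightarrow> (\<integral>\<^sup>+x. ennreal (H x t) * indicator A x \<partial>\<mu>)"
    proof (rule nn_integral_dominated_convergence[where w="\<lambda>_. 1"])
      show "AE x in \<mu>. ennreal (G (q n) x) * indicator A x \<le> 1" for n
        using G01 by (auto simp: indicator_def)
      show "AE x in \<mu>. (\<lambda>n. ennreal (G (q n) x) * indicator A x) \<longlonglongrightarrow> ennreal (H x t) * indicator A x"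
        using mono
      proof eventually_elim
        case (elim x)
        \<comment> \<open>From below, each \<open>G (q n) x\<close> dominates the infimum. From
          above, monotonicity along the rationals, available off the null set, hands a near-minimal
          value at \<open>r\<close> on to all later \<open>q n\<close>.\<close>
        have "(\<lambda>n. G (q n) x) \<longlonglongrightarrow> H x t"
        proof (rule order_tendstoI)
          fix y assume "y < H x t"
          then show "\<forall>\<^sub>F n in sequentially. y < G (q n) x"
            using H_le[OF q(1) tq] by (auto intro!: always_eventually elim: order_less_le_trans)
        next
          fix y assume "H x t < y"
          with H_less[of "y - H x t" t x] obtain r where r: "r \<in> \<rat>" "t < r" "G r x < y" by auto
          have "\<forall>\<^sub>F n in sequentially. q n < r" by (rule order_tendstoD(2)[OF q_lim r(2)])
          then show "\<forall>\<^sub>F n in sequentially. G (q n) x < y"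
          proof eventually_elim
            case (elim n)
            with \<open>\<forall>q\<in>\<rat>. \<forall>r\<in>\<rat>. q \<le> r \<longrightarrow> G q x \<le> G r x\<close> q(1) r show ?case
              by (meson less_imp_le order_le_less_trans)
          qed
        qed
        then show ?case by (cases "x \<in> A") auto
      qed
    qed auto
    moreover have "(\<lambda>n. \<integral>\<^sup>+x. ennreal (G (q n) x) * indicator A x \<partial>\<mu>) \<longlonglongrightarrow> emeasure \<pi> (A \<times> {..t})"
    proof -
      have "(\<lambda>n. emeasure \<pi> (A \<times> {..q n})) \<longlonglongrightarrow> emeasure \<pi> (\<Inter>n. A \<times> {..q n})"
        using dec by (intro Lim_emeasure_decseq) (auto simp: sets_\<pi> decseq_def le_fun_def intro: order_trans)
      also have "(\<Inter>n. A \<times> {..q n}) = A \<times> {..t}"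
      proof -
        have "b \<le> q n" if "b \<le> t" for b n using tq[of n] that by simp
        moreover have "b \<le> t" if "\<And>n. b \<le> q n" for b
          by (rule LIMSEQ_le_const[OF q_lim]) (use that in auto)
        ultimately show ?thesis by auto
      qed
      finally show ?thesis by (simp add: int_G)
    qed
    ultimately show ?thesis by (rule LIMSEQ_unique)
  qed
  have \<mu>_in: "\<mu> \<in> space (prob_algebra M)"
    by (simp add: space_prob_algebra \<mu>.prob_space_axioms)
  have bnd[measurable]: "(\<lambda>x. distr (\<kappa> x) (M \<Otimes>\<^sub>M borel) (Pair x)) \<in> M \<rightarrow>\<^sub>M prob_algebra (M \<Otimes>\<^sub>M borel)"
    by measurable
  \<comment> \<open>Rectangles whose second side is a half-line form an intersection-stable
    generator, and on them the two measures agree by \<open>int_H\<close>.\<close>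
  let ?E = "{a \<times> b |a b. a \<in> sets M \<and> b \<in> range (atMost :: real \<Rightarrow> real set)}"
  have gen: "sets (M \<Otimes>\<^sub>M (borel :: real measure)) = sigma_sets (space M \<times> UNIV) ?E"
  proof -
    have "sets (M \<Otimes>\<^sub>M (borel :: real measure)) = sets (sigma (space M \<times> space (borel :: real measure)) ?E)"
    proof (rule sets_pair_eq[where Ca="{space M}" and Cb="range (\<lambda>n. {..real n})"])
      show "\<Union> (range (\<lambda>n. {..real n})) = space borel"
        by (auto intro: real_arch_simple)
    qed (auto simp: sets.space_closed sets.sigma_sets_eq sets_atMost)
    also have "\<dots> = sigma_sets (space M \<times> UNIV) ?E"
      by (subst sets_measure_of) (auto dest: sets.sets_into_space)
    finally show ?thesis .
  qed
  have "\<pi> = \<mu> \<bind> (\<lambda>x. distr (\<kappa> x) (M \<Otimes>\<^sub>M borel) (Pair x))"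
  proof (rule measure_eqI_generator_eq[where \<Omega>="space M \<times> UNIV" and E="?E" and A="\<lambda>n. space M \<times> {..real n}"])
    show "Int_stable ?E"
    proof (rule Int_stableI)
      fix a b assume "a \<in> ?E" "b \<in> ?E"
      then obtain A s B t where "A \<in> sets M" "B \<in> sets M" "a = A \<times> {..s}" "b = B \<times> {..t}" by auto
      then have "a \<inter> b = (A \<inter> B) \<times> {..min s t}" "A \<inter> B \<in> sets M" by auto
      then show "a \<inter> b \<in> ?E" by blast
    qed
    show "sets \<pi> = sigma_sets (space M \<times> UNIV) ?E" using sets_\<pi> gen by simp
    show "sets (\<mu> \<bind> (\<lambda>x. distr (\<kappa> x) (M \<Otimes>\<^sub>M borel) (Pair x))) = sigma_sets (space M \<times> UNIV) ?E"
      using sets_bind'[OF \<mu>_in bnd] gen by simp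
    fix X assume "X \<in> ?E"
    then obtain A t where X: "X = A \<times> {..t}" and [measurable]: "A \<in> sets M" by auto
    have "emeasure (\<mu> \<bind> (\<lambda>x. distr (\<kappa> x) (M \<Otimes>\<^sub>M borel) (Pair x))) X
        = (\<integral>\<^sup>+x. emeasure (distr (\<kappa> x) (M \<Otimes>\<^sub>M borel) (Pair x)) X \<partial>\<mu>)"
      by (rule emeasure_bind_prob_algebra[OF \<mu>_in bnd]) (auto simp: X)
    also have "\<dots> = (\<integral>\<^sup>+x. ennreal (H x t) * indicator A x \<partial>\<mu>)"
    proof (rule nn_integral_cong)
      fix x assume "x \<in> space \<mu>"
      then have [measurable]: "Pair x \<in> \<kappa> x \<rightarrow>\<^sub>M M \<Otimes>\<^sub>M borel"
        by (intro measurable_Pair measurable_const measurable_ident_sets) (auto simp: \<kappa>_def)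
      have "emeasure (distr (\<kappa> x) (M \<Otimes>\<^sub>M borel) (Pair x)) X = emeasure (\<kappa> x) (Pair x -` X \<inter> space (\<kappa> x))"
        by (subst emeasure_distr) (auto simp: X)
      also have "Pair x -` X \<inter> space (\<kappa> x) = (if x \<in> A then {..t} else {})"
        by (auto simp: X \<kappa>_def)
      finally show "emeasure (distr (\<kappa> x) (M \<Otimes>\<^sub>M borel) (Pair x)) X = ennreal (H x t) * indicator A x"
        by (simp add: \<kappa>_Iic)
    qed
    finally show "emeasure \<pi> X = emeasure (\<mu> \<bind> (\<lambda>x. distr (\<kappa> x) (M \<Otimes>\<^sub>M borel) (Pair x))) X"
      by (simp add: int_H X)
  next
    show "(\<Union>n. space M \<times> {..real n}) = space M \<times> UNIV"
      by (auto intro: real_arch_simple)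
  qed (auto dest: sets.sets_into_space)
  with \<kappa> show thesis unfolding \<mu>_def by (rule that)
qed

text \<open>Reduction to the unit interval: push the second coordinate forward by \<open>f\<close>,
  disintegrate, and push the kernel back by \<open>g\<close>. Since \<open>g (f x) = x\<close> at
  every point, the original measure is recovered exactly.\<close>

lemma disintegration:
  fixes \<pi> :: "('a \<times> 'b::polish_space) measure" and M :: "'a measure"
  assumes \<pi>: "prob_space \<pi>" and sets_\<pi>[measurable_cong]: "sets \<pi> = sets (M \<Otimes>\<^sub>M borel)"
  obtains \<kappa> where "\<kappa> \<in> M \<rightarrow>\<^sub>M prob_algebra borel"
    "\<pi> = distr \<pi> M fst \<bind> (\<lambda>x. distr (\<kappa> x) (M \<Otimes>\<^sub>M borel) (Pair x))"
proof -
  obtain f :: "'b \<Rightarrow> real" and g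
    where [measurable]: "f \<in> borel_measurable borel" "g \<in> borel_measurable borel"
      and gf: "\<And>x. g (f x) = x" and f01: "\<And>x. 0 \<le> f x" "\<And>x. f x \<le> 1"
    by (rule polish_real_embedding) blast
  interpret \<pi>: prob_space \<pi> by fact
  define \<mu> where "\<mu> = distr \<pi> M fst"
  interpret \<mu>: prob_space \<mu> unfolding \<mu>_def by (rule \<pi>.prob_space_distr) measurable
  have sets_\<mu>[measurable_cong, simp]: "sets \<mu> = sets M" by (simp add: \<mu>_def)
  define \<rho> where "\<rho> = distr \<pi> (M \<Otimes>\<^sub>M borel) (\<lambda>z. (fst z, f (snd z)))"
  have \<rho>: "prob_space \<rho>" unfolding \<rho>_def by (rule \<pi>.prob_space_distr) measurable
  have sets_\<rho>[measurable_cong]: "sets \<rho> = sets (M \<Otimes>\<^sub>M borel)" by (simp add: \<rho>_def)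
  have supp: "AE z in \<rho>. 0 \<le> snd z \<and> snd z \<le> 1"
    unfolding \<rho>_def by (subst AE_distr_iff) (auto simp: f01)
  have fst_\<rho>: "distr \<rho> M fst = \<mu>"
    unfolding \<rho>_def \<mu>_def by (subst distr_distr) (auto simp: comp_def)
  obtain \<kappa> where [measurable]: "\<kappa> \<in> M \<rightarrow>\<^sub>M prob_algebra borel"
    and \<kappa>: "\<rho> = \<mu> \<bind> (\<lambda>x. distr (\<kappa> x) (M \<Otimes>\<^sub>M borel) (Pair x))"
    by (rule disintegration_unit_interval[OF \<rho> sets_\<rho> supp, unfolded fst_\<rho>])
  let ?K = "\<lambda>x. distr (\<kappa> x) (M \<Otimes>\<^sub>M borel) (Pair x)"
  have "?K \<in> M \<rightarrow>\<^sub>M prob_algebra (M \<Otimes>\<^sub>M borel)" by measurable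
  then have K: "?K \<in> \<mu> \<rightarrow>\<^sub>M prob_algebra (M \<Otimes>\<^sub>M borel)"
    by (simp cong: measurable_cong_sets)
  have "\<pi> = distr \<rho> (M \<Otimes>\<^sub>M borel) (\<lambda>z. (fst z, g (snd z)))"
    unfolding \<rho>_def by (subst distr_distr) (simp_all add: comp_def gf distr_id2[OF sets_\<pi>[symmetric]])
  also have "\<dots> = \<mu> \<bind> (\<lambda>x. distr (?K x) (M \<Otimes>\<^sub>M borel) (\<lambda>z. (fst z, g (snd z))))"
    unfolding \<kappa> by (rule distr_bind[OF measurable_prob_algebraD[OF K] \<mu>.not_empty]) measurable
  also have "\<dots> = \<mu> \<bind> (\<lambda>x. distr (distr (\<kappa> x) borel g) (M \<Otimes>\<^sub>M borel) (Pair x))"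
  proof (rule bind_cong[OF refl])
    fix x assume "x \<in> space \<mu>"
    then have x: "x \<in> space M" by (simp add: \<mu>_def)
    then have sets_\<kappa>[measurable_cong]: "sets (\<kappa> x) = sets borel"
      using measurable_space[OF \<open>\<kappa> \<in> M \<rightarrow>\<^sub>M prob_algebra borel\<close>] by (simp add: space_prob_algebra)
    have [measurable]: "Pair x \<in> \<kappa> x \<rightarrow>\<^sub>M M \<Otimes>\<^sub>M borel"
      using x sets_\<kappa> by (intro measurable_Pair measurable_const measurable_ident_sets) simp_all
    have Pair': "Pair x \<in> borel \<rightarrow>\<^sub>M M \<Otimes>\<^sub>M (borel :: 'b measure)"
      using x by (intro measurable_Pair measurable_const) auto
    have g: "g \<in> \<kappa> x \<rightarrow>\<^sub>M borel" by measurable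
    have "distr (?K x) (M \<Otimes>\<^sub>M borel) (\<lambda>z. (fst z, g (snd z))) = distr (\<kappa> x) (M \<Otimes>\<^sub>M borel) (\<lambda>r. (x, g r))"
      by (subst distr_distr) (simp_all add: comp_def)
    also have "\<dots> = distr (distr (\<kappa> x) borel g) (M \<Otimes>\<^sub>M borel) (Pair x)"
      unfolding distr_distr[OF Pair' g] comp_def ..
    finally show "distr (?K x) (M \<Otimes>\<^sub>M borel) (\<lambda>z. (fst z, g (snd z)))
        = distr (distr (\<kappa> x) borel g) (M \<Otimes>\<^sub>M borel) (Pair x)" .
  qed
  finally show thesis
    unfolding \<mu>_def by (intro that[of "\<lambda>x. distr (\<kappa> x) borel g"]) measurable
qed

section \<open>Gluing of couplings and Markov chains\<close>

lemma borel_measurable_fst [measurable]: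
  "fst \<in> borel \<rightarrow>\<^sub>M (borel :: 'a::topological_space measure)"
  by (intro borel_measurable_continuous_onI continuous_intros)

lemma borel_measurable_snd [measurable]:
  "snd \<in> borel \<rightarrow>\<^sub>M (borel :: 'a::topological_space measure)"
  by (intro borel_measurable_continuous_onI continuous_intros)

lemma distr_compose:
  assumes "sets M = sets K" and "g \<in> K \<rightarrow>\<^sub>M L" and "f \<in> L \<rightarrow>\<^sub>M N"
  shows "distr (distr M L g) N f = distr M N (\<lambda>x. f (g x))"
  using assms by (subst distr_distr) (auto simp: comp_def cong: measurable_cong_sets)

text \<open>Sample from \<open>\<theta>\<close>, then draw one more coordinate from the conditional
  law of \<open>\<gamma>\<close> given that its first coordinate equals \<open>Y\<close>. The state
  space \<open>S\<close> is left general so that coordinates can be appended repeatedly to a product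
  already built.\<close>

lemma gluing:
  fixes \<gamma> :: "('b::polish_space \<times> 'c::polish_space) measure" and \<theta> S :: "'s measure"
  assumes \<theta>: "\<theta> \<in> space (prob_algebra S)" and Y[measurable]: "Y \<in> S \<rightarrow>\<^sub>M borel"
    and \<gamma>: "\<gamma> \<in> borel_probs" and eq: "distr \<theta> borel Y = distr \<gamma> borel fst"
  obtains \<theta>' where "\<theta>' \<in> space (prob_algebra (S \<Otimes>\<^sub>M borel))" "distr \<theta>' S fst = \<theta>"
    "distr \<theta>' borel (\<lambda>z. (Y (fst z), snd z)) = \<gamma>"
proof -
  have sets_\<theta>[measurable_cong, simp]: "sets \<theta> = sets S" and "prob_space \<theta>"
    using \<theta> by (auto simp: space_prob_algebra)
  interpret \<theta>: prob_space \<theta> by fact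
  have sets_\<gamma>: "sets \<gamma> = sets (borel \<Otimes>\<^sub>M borel)" and \<gamma>_prob: "prob_space \<gamma>"
    using \<gamma> unfolding borel_probs_iff borel_prod by blast+
  obtain \<kappa> :: "'b \<Rightarrow> 'c measure" where \<kappa>[measurable]: "\<kappa> \<in> borel \<rightarrow>\<^sub>M prob_algebra borel"
    and \<gamma>_eq: "\<gamma> = distr \<gamma> borel fst \<bind> (\<lambda>x. distr (\<kappa> x) (borel \<Otimes>\<^sub>M borel) (Pair x))"
    by (rule disintegration[OF \<gamma>_prob sets_\<gamma>])
  have sets_\<kappa>[measurable_cong, simp]: "sets (\<kappa> y) = sets borel" for y
    using measurable_space[OF \<kappa>, of y] by (simp add: space_prob_algebra)
  have \<kappa>_prob: "prob_space (\<kappa> y)" for y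
    using measurable_space[OF \<kappa>, of y] by (simp add: space_prob_algebra)
  let ?K = "\<lambda>s. distr (\<kappa> (Y s)) (S \<Otimes>\<^sub>M borel) (Pair s)"
  have K: "?K \<in> S \<rightarrow>\<^sub>M prob_algebra (S \<Otimes>\<^sub>M borel)" by measurable
  then have K': "?K \<in> \<theta> \<rightarrow>\<^sub>M subprob_algebra (S \<Otimes>\<^sub>M borel)"
    by (intro measurable_prob_algebraD) (simp cong: measurable_cong_sets)
  have Pair_meas: "Pair s \<in> \<kappa> y \<rightarrow>\<^sub>M S \<Otimes>\<^sub>M borel" if "s \<in> space \<theta>" for s y
    using that sets_eq_imp_space_eq[OF sets_\<theta>] by (intro measurable_Pair measurable_const measurable_ident_sets) auto
  define \<theta>' where "\<theta>' = \<theta> \<bind> ?K"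
  show thesis
  proof (rule that)
    show "\<theta>' \<in> space (prob_algebra (S \<Otimes>\<^sub>M borel))"
      unfolding \<theta>'_def using prob_space_bind'[OF \<theta> K] sets_bind'[OF \<theta> K] by (simp add: space_prob_algebra)
    have "distr \<theta>' S fst = \<theta> \<bind> (\<lambda>s. distr (?K s) S fst)"
      unfolding \<theta>'_def by (rule distr_bind[OF K' \<theta>.not_empty]) measurable
    also have "\<dots> = \<theta> \<bind> return S"
    proof (rule bind_cong[OF refl])
      fix s assume s: "s \<in> space \<theta>"
      then have "distr (?K s) S fst = distr (\<kappa> (Y s)) S (\<lambda>_. s)"
        using Pair_meas by (simp add: distr_distr comp_def)
      also have "\<dots> = return S s"
        using s sets_eq_imp_space_eq[OF sets_\<theta>] by (intro prob_space.distr_const \<kappa>_prob) auto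
      finally show "distr (?K s) S fst = return S s" .
    qed
    also have "\<dots> = \<theta>" by (rule bind_return'') simp
    finally show "distr \<theta>' S fst = \<theta>" .
    have "distr \<theta>' (borel \<Otimes>\<^sub>M borel) (\<lambda>z. (Y (fst z), snd z))
        = \<theta> \<bind> (\<lambda>s. distr (?K s) (borel \<Otimes>\<^sub>M borel) (\<lambda>z. (Y (fst z), snd z)))"
      unfolding \<theta>'_def by (rule distr_bind[OF K' \<theta>.not_empty]) measurable
    also have "\<dots> = \<theta> \<bind> (\<lambda>s. distr (\<kappa> (Y s)) (borel \<Otimes>\<^sub>M borel) (Pair (Y s)))"
      using Pair_meas by (intro bind_cong[OF refl]) (simp add: distr_distr comp_def)
    also have "\<dots> = distr \<theta> borel Y \<bind> (\<lambda>y. distr (\<kappa> y) (borel \<Otimes>\<^sub>M borel) (Pair y))"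
      by (intro bind_distr[symmetric, where K="borel \<Otimes>\<^sub>M borel"] measurable_prob_algebraD \<theta>.not_empty) measurable
    also have "\<dots> = \<gamma>" unfolding eq by (rule \<gamma>_eq[symmetric])
    finally show "distr \<theta>' borel (\<lambda>z. (Y (fst z), snd z)) = \<gamma>" by (simp add: borel_prod)
  qed
qed

text \<open>The Markov chain that moves from \<open>x\<^sub>1\<close> to \<open>x\<^sub>2\<close> by \<open>P i\<close> and
  from \<open>x\<^sub>2\<close> to the next \<open>x\<^sub>1\<close> by \<open>Q i\<close>.\<close>

lemma alternating_chain:
  fixes P Q :: "nat \<Rightarrow> ('a::polish_space \<times> 'b::polish_space) measure"
  assumes P: "\<And>i. P i \<in> borel_probs" and Q: "\<And>i. Q i \<in> borel_probs"
    and Q1: "\<And>i. distr (Q i) borel fst = distr (P (Suc i)) borel fst"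
    and Q2: "\<And>i. distr (Q i) borel snd = distr (P i) borel snd"
  shows "1 \<le> n \<Longrightarrow> \<exists>\<theta>\<in>space (prob_algebra (Pi\<^sub>M {1..n} (\<lambda>_. borel))).
    (\<forall>i\<in>{1..n}. distr \<theta> borel (\<lambda>x. x i) = P i) \<and>
    (\<forall>i\<in>{1..<n}. distr \<theta> borel (\<lambda>x. (fst (x (Suc i)), snd (x i))) = Q i)"
proof (induction n rule: nat_induct_at_least)
  case base
  interpret P: prob_space "P 1" using P borel_probs_iff by auto
  have sets_P[measurable_cong]: "sets (P 1) = sets borel" using P borel_probs_iff by auto
  have meas[measurable]: "(\<lambda>z. \<lambda>i\<in>{1..1}. z) \<in> P 1 \<rightarrow>\<^sub>M Pi\<^sub>M {1..1::nat} (\<lambda>_. borel)"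
    by measurable
  let ?\<theta> = "distr (P 1) (Pi\<^sub>M {1..1::nat} (\<lambda>_. borel)) (\<lambda>z. \<lambda>i\<in>{1..1}. z)"
  have "prob_space ?\<theta>" by (rule P.prob_space_distr) measurable
  then have "?\<theta> \<in> space (prob_algebra (Pi\<^sub>M {1..1} (\<lambda>_. borel)))"
    by (simp only: space_prob_algebra mem_Collect_eq sets_distr simp_thms)
  moreover have "distr ?\<theta> borel (\<lambda>x. x 1) = P 1"
  proof -
    have "distr ?\<theta> borel (\<lambda>x. x 1) = distr (P 1) borel (\<lambda>z. z)"
      by (subst distr_distr[OF measurable_component_singleton meas]) (simp_all add: comp_def)
    then show ?thesis using sets_P by (simp only: distr_id2)
  qed
  ultimately show ?case by (intro bexI[of _ ?\<theta>]) auto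
next
  case (Suc n)
  note One_nat_def[simp del]
  let ?S = "Pi\<^sub>M {1..n} (\<lambda>_. borel :: ('a \<times> 'b) measure)"
  let ?S' = "Pi\<^sub>M {1..Suc n} (\<lambda>_. borel :: ('a \<times> 'b) measure)"
  from Suc obtain \<theta> where \<theta>: "\<theta> \<in> space (prob_algebra ?S)"
    and \<theta>P: "\<And>i. i \<in> {1..n} \<Longrightarrow> distr \<theta> borel (\<lambda>x. x i) = P i"
    and \<theta>Q: "\<And>i. i \<in> {1..<n} \<Longrightarrow> distr \<theta> borel (\<lambda>x. (fst (x (Suc i)), snd (x i))) = Q i"
    by blast
  have n[simp]: "n \<in> {1..n}" using Suc by auto
  have sets_\<theta>: "sets \<theta> = sets ?S" using \<theta> by (auto simp: space_prob_algebra)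
  have sets_PQ: "sets (P i) = sets borel" "sets (Q i) = sets borel" for i
    using P Q borel_probs_iff by auto
  have comp[measurable]: "(\<lambda>x. x n) \<in> ?S \<rightarrow>\<^sub>M borel"
    by (rule measurable_component_singleton[OF n])
  have [measurable]: "(\<lambda>z. fst z n) \<in> ?S \<Otimes>\<^sub>M (borel :: 'a measure) \<rightarrow>\<^sub>M borel"
    by (rule measurable_compose[OF measurable_fst comp])
  have [measurable]: "(\<lambda>z. fst (fst z) n) \<in> (?S \<Otimes>\<^sub>M (borel :: 'a measure)) \<Otimes>\<^sub>M (borel :: 'b measure) \<rightarrow>\<^sub>M borel"
    by (rule measurable_compose[OF measurable_fst]) measurable
  interpret Q: prob_space "Q n" using Q borel_probs_iff by auto
  \<comment> \<open>The link \<open>Q n\<close> is traversed from its second coordinate to its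
    first, whereas \<open>gluing\<close> conditions on the first coordinate; hence the swap.\<close>
  define R where "R = distr (Q n) borel (\<lambda>z. (snd z, fst z))"
  have swap[measurable]: "(\<lambda>z. (snd z, fst z)) \<in> borel \<rightarrow>\<^sub>M (borel :: ('b \<times> 'a) measure)"
    by (intro borel_measurable_continuous_onI continuous_intros)
  then have "prob_space R"
    unfolding R_def by (intro Q.prob_space_distr) (simp add: measurable_cong_sets[OF sets_PQ(2) refl])
  then have R: "R \<in> borel_probs"
    unfolding R_def borel_probs_iff by simp
  have eq1: "distr \<theta> borel (\<lambda>x. snd (x n)) = distr R borel fst"
  proof -
    have "distr \<theta> borel (\<lambda>x. snd (x n)) = distr (distr \<theta> borel (\<lambda>x. x n)) borel snd"
      by (subst distr_compose[OF sets_\<theta>]) measurable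
    also have "\<dots> = distr (Q n) borel snd" unfolding \<theta>P[OF n] Q2 ..
    also have "\<dots> = distr R borel fst"
      unfolding R_def by (subst distr_compose[OF sets_PQ(2)]) simp_all
    finally show ?thesis .
  qed
  \<comment> \<open>First half-step: append the first component of position \<open>Suc n\<close>
    through \<open>Q n\<close>. The second half-step, \<open>\<theta>2\<close>, appends its second
    component through \<open>P (Suc n)\<close>.\<close>
  obtain \<theta>1 where \<theta>1: "\<theta>1 \<in> space (prob_algebra (?S \<Otimes>\<^sub>M borel))" "distr \<theta>1 ?S fst = \<theta>"
    "distr \<theta>1 borel (\<lambda>z. (snd (fst z n), snd z)) = R"
    by (rule gluing[OF \<theta> _ R eq1]) measurable
  have sets_\<theta>1: "sets \<theta>1 = sets (?S \<Otimes>\<^sub>M borel)" using \<theta>1 by (auto simp: space_prob_algebra)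
  have Qn: "distr \<theta>1 borel (\<lambda>z. (snd z, snd (fst z n))) = Q n"
  proof -
    have "distr \<theta>1 borel (\<lambda>z. (snd z, snd (fst z n)))
        = distr (distr \<theta>1 borel (\<lambda>z. (snd (fst z n), snd z))) borel (\<lambda>z. (snd z, fst z))"
      by (subst distr_compose[OF sets_\<theta>1]) simp_all
    also have "\<dots> = Q n"
      unfolding \<theta>1 R_def by (subst distr_compose[OF sets_PQ(2)]) (simp_all add: distr_id2[OF sets_PQ(2)[symmetric]])
    finally show ?thesis .
  qed
  have eq2: "distr \<theta>1 borel snd = distr (P (Suc n)) borel fst"
  proof -
    have "distr \<theta>1 borel snd = distr (distr \<theta>1 borel (\<lambda>z. (snd z, snd (fst z n)))) borel fst"
      by (subst distr_compose[OF sets_\<theta>1]) simp_all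
    also have "\<dots> = distr (P (Suc n)) borel fst" by (simp add: Qn Q1)
    finally show ?thesis .
  qed
  obtain \<theta>2 where \<theta>2: "\<theta>2 \<in> space (prob_algebra ((?S \<Otimes>\<^sub>M borel) \<Otimes>\<^sub>M borel))"
    "distr \<theta>2 (?S \<Otimes>\<^sub>M borel) fst = \<theta>1" "distr \<theta>2 borel (\<lambda>z. (snd (fst z), snd z)) = P (Suc n)"
    by (rule gluing[OF \<theta>1(1) _ P eq2]) measurable
  have sets_\<theta>2: "sets \<theta>2 = sets ((?S \<Otimes>\<^sub>M borel) \<Otimes>\<^sub>M borel)" and \<theta>2_prob: "prob_space \<theta>2"
    using \<theta>2 by (auto simp: space_prob_algebra)
  define T :: "((nat \<Rightarrow> 'a \<times> 'b) \<times> 'a) \<times> 'b \<Rightarrow> nat \<Rightarrow> 'a \<times> 'b"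
    where "T z = (fst (fst z))(Suc n := (snd (fst z), snd z))" for z
  have T[measurable]: "T \<in> (?S \<Otimes>\<^sub>M borel) \<Otimes>\<^sub>M borel \<rightarrow>\<^sub>M ?S'"
    unfolding T_def by (rule measurable_fun_upd[where J="{1..n}"]) (use Suc in auto)
  have comp': "(\<lambda>x. x i) \<in> ?S' \<rightarrow>\<^sub>M borel" if "i \<in> {1..Suc n}" for i
    using that by (rule measurable_component_singleton)
  let ?\<theta> = "distr \<theta>2 ?S' T"
  \<comment> \<open>A function of the old coordinates keeps its law, because both gluings preserve
    what they extend.\<close>
  have sub: "distr ?\<theta> borel h = distr \<theta> borel h'"
    if h: "h \<in> ?S' \<rightarrow>\<^sub>M borel" and h': "h' \<in> ?S \<rightarrow>\<^sub>M borel" and eq: "\<And>z. h (T z) = h' (fst (fst z))"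
    for h h' :: "(nat \<Rightarrow> 'a \<times> 'b) \<Rightarrow> 'a \<times> 'b"
  proof -
    have "distr ?\<theta> borel h = distr \<theta>2 borel (\<lambda>z. h' (fst (fst z)))"
      by (simp add: distr_compose[OF sets_\<theta>2 T h] eq)
    also have "\<dots> = distr (distr \<theta>2 (?S \<Otimes>\<^sub>M borel) fst) borel (\<lambda>z. h' (fst z))"
      by (rule distr_compose[OF sets_\<theta>2, symmetric]) (use h' in measurable)
    also have "\<dots> = distr (distr \<theta>1 ?S fst) borel h'"
      unfolding \<theta>2 by (rule distr_compose[OF sets_\<theta>1, symmetric]) (use h' in measurable)
    finally show ?thesis by (simp add: \<theta>1)
  qed
  have "prob_space ?\<theta>"
    using T by (intro prob_space.prob_space_distr[OF \<theta>2_prob]) (simp add: measurable_cong_sets[OF sets_\<theta>2 refl])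
  then have "?\<theta> \<in> space (prob_algebra ?S')"
    by (simp add: space_prob_algebra)
  moreover have "distr ?\<theta> borel (\<lambda>x. x i) = P i" if i: "i \<in> {1..Suc n}" for i
  proof (cases "i = Suc n")
    case True
    then show ?thesis
      unfolding distr_compose[OF sets_\<theta>2 T comp'[OF i]] by (simp add: T_def \<theta>2)
  next
    case False
    with i have i': "i \<in> {1..n}" by auto
    have "distr ?\<theta> borel (\<lambda>x. x i) = distr \<theta> borel (\<lambda>x. x i)"
      by (rule sub[OF comp'[OF i] measurable_component_singleton[OF i']]) (use False in \<open>auto simp: T_def\<close>)
    then show ?thesis using \<theta>P[OF i'] by simp
  qed
  moreover have "distr ?\<theta> borel (\<lambda>x. (fst (x (Suc i)), snd (x i))) = Q i" if i: "i \<in> {1..<Suc n}" for i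
  proof -
    have [measurable]: "(\<lambda>x. x i) \<in> ?S' \<rightarrow>\<^sub>M borel" "(\<lambda>x. x (Suc i)) \<in> ?S' \<rightarrow>\<^sub>M borel"
      using i by (auto intro!: comp')
    have h: "(\<lambda>x. (fst (x (Suc i)), snd (x i))) \<in> ?S' \<rightarrow>\<^sub>M borel"
      by measurable
    show ?thesis
    proof (cases "i = n")
      case True
      have "distr ?\<theta> borel (\<lambda>x. (fst (x (Suc i)), snd (x i)))
          = distr \<theta>2 borel (\<lambda>z. (snd (fst z), snd (fst (fst z) n)))"
        unfolding distr_compose[OF sets_\<theta>2 T h] using True by (simp add: T_def)
      also have "\<dots> = distr (distr \<theta>2 (?S \<Otimes>\<^sub>M borel) fst) borel (\<lambda>z. (snd z, snd (fst z n)))"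
        by (rule distr_compose[OF sets_\<theta>2, symmetric]) measurable
      also have "\<dots> = Q i" by (simp add: \<theta>2 Qn True)
      finally show ?thesis .
    next
      case False
      with i have i': "i \<in> {1..<n}" by auto
      then have [measurable]: "(\<lambda>x. x i) \<in> ?S \<rightarrow>\<^sub>M borel" "(\<lambda>x. x (Suc i)) \<in> ?S \<rightarrow>\<^sub>M borel"
        by (auto intro!: measurable_component_singleton)
      have "(\<lambda>x. (fst (x (Suc i)), snd (x i))) \<in> ?S \<rightarrow>\<^sub>M borel"
        by measurable
      from sub[OF h this] i' \<theta>Q[OF i'] show ?thesis by (simp add: T_def)
    qed
  qed
  ultimately show ?case by (intro bexI[of _ ?\<theta>]) auto
qed

section \<open>Rearrangements and potentials\<close>

text \<open>The backward cyclic shift of \<open>{1..n}\<close>. It pairs the first component of each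
  position with the second component of the preceding one, which is the pair governed by a link
  \<open>Q i\<close> of the chain, except for the closing pair at position 1.\<close>

definition cyc :: "nat \<Rightarrow> nat \<Rightarrow> nat" where
  "cyc n i = (if i = 1 then n else if 1 < i \<and> i \<le> n then i - 1 else i)"

lemma cyc_permutes: "1 \<le> n \<Longrightarrow> cyc n permutes {1..n}"
proof (rule bij_imp_permutes)
  assume "1 \<le> n"
  then show "bij_betw (cyc n) {1..n} {1..n}"
    by (intro bij_betw_byWitness[where f'="\<lambda>i. if i = n then 1 else i + 1"])
      (auto simp: cyc_def)
  show "cyc n x = x" if "x \<notin> {1..n}" for x
    using that \<open>1 \<le> n\<close> by (auto simp: cyc_def)
qed

lemma sum_atLeast1_atMost_shift:
  fixes h :: "nat \<Rightarrow> 'a::comm_monoid_add"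
  shows "1 \<le> n \<Longrightarrow> (\<Sum>i=1..n. h i) = h 1 + (\<Sum>i=1..<n. h (Suc i))"
  by (induction n rule: nat_induct_at_least) (simp_all add: add.assoc)

text \<open>If \<open>p\<close> exceeded \<open>q\<close>, then \<open>n * (p - q)\<close> would
  outgrow the constant \<open>K\<close>. The instance \<open>n = 1\<close> gives
  \<open>p \<le> K\<close>, so once \<open>q\<close> is finite the whole argument takes place in the
  reals.\<close>

lemma ennreal_le_of_linear_growth:
  fixes p q K :: ennreal
  assumes le: "\<And>n::nat. 1 \<le> n \<Longrightarrow> of_nat n * p \<le> of_nat (n - 1) * q + K" and K: "K < \<infinity>"
  shows "p \<le> q"
proof (cases "q = \<infinity>")
  case False
  have "p \<le> K" using le[of 1] by simp
  then have "p < \<infinity>" using K by (rule order_le_less_trans)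
  with K False obtain p' q' K' where r: "p = ennreal p'" "0 \<le> p'" "q = ennreal q'" "0 \<le> q'" "K = ennreal K'" "0 \<le> K'"
    by (cases p; cases q; cases K) auto
  have le': "real n * p' \<le> real n * q' + K'" if "1 \<le> n" for n
  proof -
    have "ennreal (real n * p') \<le> ennreal (real (n - 1) * q' + K')"
      using le[OF that] r by (simp add: ennreal_of_nat_eq_real_of_nat ennreal_mult)
    then have "real n * p' \<le> real (n - 1) * q' + K'"
      using r by (subst (asm) ennreal_le_iff) auto
    also have "\<dots> \<le> real n * q' + K'"
      using r by (intro add_right_mono mult_right_mono) auto
    finally show ?thesis .
  qed
  have "p' \<le> q'"
  proof (rule ccontr)
    assume "\<not> p' \<le> q'"
    then obtain n where n: "K' < real n * (p' - q')"
      using reals_Archimedean3[of "p' - q'"] by auto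
    with r have "1 \<le> n" by (cases n) auto
    from le'[OF this] n show False by (simp add: algebra_simps)
  qed
  with r show ?thesis by (simp add: ennreal_leI)
qed simp

text \<open>The lower bound is known only for joint choices of competitors, so the infima are
  approximated simultaneously: a near-minimiser in each index, with small total error.\<close>

lemma sum_INF_ge:
  fixes f :: "'i \<Rightarrow> 'a \<Rightarrow> ennreal"
  assumes "finite I"
    and le: "\<And>g. (\<And>i. i \<in> I \<Longrightarrow> g i \<in> A i) \<Longrightarrow> x \<le> (\<Sum>i\<in>I. f i (g i))"
  shows "x \<le> (\<Sum>i\<in>I. INF a\<in>A i. f i a)"
proof (rule ennreal_le_epsilon)
  fix e :: real assume fin: "(\<Sum>i\<in>I. INF a\<in>A i. f i a) < top" and "0 < e"
  \<comment> \<open>The error is shared among the indices; the summand 1 covers an empty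
    \<open>I\<close>.\<close>
  define d where "d = e / (1 + real (card I))"
  have d: "0 < d" "real (card I) * d \<le> e"
    using \<open>0 < e\<close> by (auto simp: d_def field_simps)
  have "\<exists>a\<in>A i. f i a < (INF a\<in>A i. f i a) + ennreal d" if "i \<in> I" for i
  proof -
    have "(INF a\<in>A i. f i a) < top" using fin \<open>finite I\<close> that by (simp add: ennreal_sum_less_top)
    then have "(INF a\<in>A i. f i a) < (INF a\<in>A i. f i a) + ennreal d"
      using d by (cases "INF a\<in>A i. f i a") (auto simp: ennreal_less_iff simp flip: ennreal_plus)
    then show ?thesis by (simp only: INF_less_iff)
  qed
  then obtain g where g: "\<And>i. i \<in> I \<Longrightarrow> g i \<in> A i \<and> f i (g i) < (INF a\<in>A i. f i a) + ennreal d"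
    by metis
  then have "x \<le> (\<Sum>i\<in>I. f i (g i))" by (intro le) auto
  also have "\<dots> \<le> (\<Sum>i\<in>I. (INF a\<in>A i. f i a) + ennreal d)"
    using g by (intro sum_mono) (auto intro: less_imp_le)
  also have "\<dots> = (\<Sum>i\<in>I. INF a\<in>A i. f i a) + ennreal (real (card I) * d)"
    using d by (simp add: sum.distrib ennreal_of_nat_eq_real_of_nat ennreal_mult)
  also have "\<dots> \<le> (\<Sum>i\<in>I. INF a\<in>A i. f i a) + ennreal e"
    using d by (intro add_left_mono ennreal_leI)
  finally show "x \<le> (\<Sum>i\<in>I. INF a\<in>A i. f i a) + ennreal e" .
qed

section \<open>Rockafellar's potential\<close>

text \<open>The potential is an infimum over finite chains in \<open>G\<close> that start at a base
  point \<open>m0\<close>. By \<open>cm\<close>, closing a chain at the base point gives a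
  nonnegative value, so the potential is not identically \<open>-\<infinity>\<close>; appending one
  more pair to a chain gives the superdifferential inequality.\<close>

lemma rockafellar:
  fixes C :: "'s \<Rightarrow> 't \<Rightarrow> real" and G :: "('s \<times> 't) set"
  assumes "G \<noteq> {}"
    and cm: "\<And>n m. (\<And>i. i \<le> n \<Longrightarrow> m i \<in> G) \<Longrightarrow>
      (\<Sum>i\<le>n. C (fst (m i)) (snd (m i))) \<le> C (fst (m 0)) (snd (m n)) + (\<Sum>i<n. C (fst (m (Suc i))) (snd (m i)))"
  obtains A \<phi> where "A \<subseteq> snd ` G \<times> (UNIV :: real set)"
    "\<And>s. \<phi> s = (INF (t, \<alpha>)\<in>A. ereal (C s t) - ereal \<alpha>)"
    "\<And>s. \<phi> s < \<infinity>" "\<exists>s\<in>fst ` G. \<phi> s \<noteq> -\<infinity>"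
    "\<And>s t s'. (s, t) \<in> G \<Longrightarrow> ereal (C s t - C s' t) \<le> \<phi> s - \<phi> s'"
proof -
  obtain m0 where m0: "m0 \<in> G" using \<open>G \<noteq> {}\<close> by auto
  \<comment> \<open>With \<open>(s_i, t_i) = m i\<close>, the number \<open>C s t_n - v m n\<close>
    is the classical expression
    \<open>C s t_n - C s_n t_n + C s_n t_{n-1} - ... - C s_0 t_0\<close>.\<close>
  define v where "v m n = (\<Sum>i\<le>n. C (fst (m i)) (snd (m i))) - (\<Sum>i<n. C (fst (m (Suc i))) (snd (m i)))"
    for m :: "nat \<Rightarrow> 's \<times> 't" and n
  define A where "A = {(snd (m n), v m n) |m n. m 0 = m0 \<and> (\<forall>i\<le>n. m i \<in> G)}"
  define \<phi> where "\<phi> s = (INF (t, \<alpha>)\<in>A. ereal (C s t) - ereal \<alpha>)" for s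
  have A: "A \<subseteq> snd ` G \<times> UNIV" by (auto simp: A_def)
  have A0: "(snd m0, C (fst m0) (snd m0)) \<in> A"
    unfolding A_def by (auto simp: m0 v_def intro!: exI[of _ "\<lambda>_. m0"] exI[of _ 0])
  have A_step: "(t', C s' t' - C s' t + \<alpha>) \<in> A" if "(t, \<alpha>) \<in> A" "(s', t') \<in> G" for t \<alpha> s' t'
  proof -
    from that obtain m n where m: "t = snd (m n)" "\<alpha> = v m n" "m 0 = m0" "\<forall>i\<le>n. m i \<in> G"
      by (auto simp: A_def)
    let ?m = "m(Suc n := (s', t'))"
    have "v ?m (Suc n) = C s' t' - C s' t + \<alpha>"
      by (simp add: v_def m)
    moreover have "?m 0 = m0" "\<forall>i\<le>Suc n. ?m i \<in> G" using m that(2) by (auto simp: le_Suc_eq)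
    ultimately show ?thesis
      unfolding A_def by (auto intro!: exI[of _ ?m] exI[of _ "Suc n"])
  qed
  have \<phi>_le: "\<phi> s \<le> ereal (C s t - \<alpha>)" if "(t, \<alpha>) \<in> A" for s t \<alpha>
    unfolding \<phi>_def by (rule INF_lower2[OF that]) simp
  have \<phi>_ge: "x \<le> \<phi> s" if "\<And>t \<alpha>. (t, \<alpha>) \<in> A \<Longrightarrow> x \<le> ereal (C s t - \<alpha>)" for x s
    unfolding \<phi>_def by (rule INF_greatest) (use that in auto)
  have fin: "\<phi> s < \<infinity>" for s
    using \<phi>_le[OF A0, of s] by (rule order_le_less_trans) simp
  have nonneg: "0 \<le> \<phi> (fst m0)"
  proof (rule \<phi>_ge)
    fix t \<alpha> assume "(t, \<alpha>) \<in> A"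
    then obtain m n where "t = snd (m n)" "\<alpha> = v m n" "m 0 = m0" "\<forall>i\<le>n. m i \<in> G"
      by (auto simp: A_def)
    with cm[of n m] show "0 \<le> ereal (C (fst m0) t - \<alpha>)" by (simp add: v_def)
  qed
  have key: "\<phi> s' + ereal (C s t - C s' t) \<le> \<phi> s" if "(s, t) \<in> G" for s t s'
  proof (rule \<phi>_ge)
    fix u \<alpha> assume "(u, \<alpha>) \<in> A"
    from \<phi>_le[OF A_step[OF this that], of s']
    have "\<phi> s' + ereal (C s t - C s' t) \<le> ereal (C s' t - (C s t - C s u + \<alpha>)) + ereal (C s t - C s' t)"
      by (rule add_right_mono)
    then show "\<phi> s' + ereal (C s t - C s' t) \<le> ereal (C s u - \<alpha>)" by simp
  qed
  show thesis
  proof (rule that[OF A \<phi>_def fin])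
    show "\<exists>s\<in>fst ` G. \<phi> s \<noteq> -\<infinity>" using nonneg m0 by (intro bexI[of _ "fst m0"]) auto
    fix s t s' assume st: "(s, t) \<in> G"
    \<comment> \<open>Comparison with the base point shows that \<open>\<phi>\<close> is finite on
      the first projection of \<open>G\<close>. This turns the additive form \<open>key\<close> into
      a difference, which is \<open>\<infinity>\<close> if
      \<open>\<phi> s' = -\<infinity>\<close>.\<close>
    have "\<phi> s \<noteq> -\<infinity>"
      using key[OF st, of "fst m0"] nonneg by (cases "\<phi> (fst m0)") auto
    with fin[of s] obtain r where r: "\<phi> s = ereal r" by (cases "\<phi> s") auto
    show "ereal (C s t - C s' t) \<le> \<phi> s - \<phi> s'"
      using key[OF st, of s'] fin[of s'] by (cases "\<phi> s'") (auto simp: r)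
  qed
qed

text \<open>Connects nonnegative integrals of costs with the Bochner integral in
  \<open>total_superdiff\<close>.\<close>

lemma enn2real_integral:
  fixes f :: "'a \<Rightarrow> ennreal"
  assumes [measurable]: "f \<in> borel_measurable M" and fin: "(\<integral>\<^sup>+x. f x \<partial>M) < \<infinity>"
  shows "integrable M (\<lambda>x. enn2real (f x))"
    and "(\<integral>x. enn2real (f x) \<partial>M) = enn2real (\<integral>\<^sup>+x. f x \<partial>M)"
proof -
  have "AE x in M. f x \<noteq> \<infinity>" by (rule nn_integral_PInf_AE) (use fin in auto)
  then have eq: "(\<integral>\<^sup>+x. ennreal (enn2real (f x)) \<partial>M) = (\<integral>\<^sup>+x. f x \<partial>M)"
    by (intro nn_integral_cong_AE) (auto simp: less_top elim!: eventually_mono)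
  show "integrable M (\<lambda>x. enn2real (f x))"
    by (rule integrableI_nonneg) (use fin eq in auto)
  show "(\<integral>x. enn2real (f x) \<partial>M) = enn2real (\<integral>\<^sup>+x. f x \<partial>M)"
    by (subst integral_eq_nn_integral) (auto simp: eq)
qed

section \<open>Transport costs\<close>

lemma couplingsD:
  assumes "\<gamma> \<in> couplings \<mu>1 \<mu>2"
  shows "\<gamma> \<in> borel_probs" "distr \<gamma> borel fst = \<mu>1" "distr \<gamma> borel snd = \<mu>2"
  using assms by (auto simp: couplings_def)

text \<open>The product measure is a coupling; its second marginal is reduced to a first one by
  swapping the factors.\<close>

lemma couplings_nonempty:
  fixes \<mu>1 :: "'a::second_countable_topology measure" and \<mu>2 :: "'b::second_countable_topology measure"
  assumes "\<mu>1 \<in> borel_probs" "\<mu>2 \<in> borel_probs"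
  shows "couplings \<mu>1 \<mu>2 \<noteq> {}"
proof -
  have p: "prob_space \<mu>1" "prob_space \<mu>2" and s: "sets \<mu>1 = sets borel" "sets \<mu>2 = sets borel"
    using assms unfolding borel_probs_iff by auto
  interpret pair_prob_space \<mu>1 \<mu>2 by (intro pair_prob_space.intro pair_sigma_finite.intro p prob_space_imp_sigma_finite)
  have sets: "sets (\<mu>1 \<Otimes>\<^sub>M \<mu>2) = sets borel"
    using sets_pair_measure_cong[OF s] unfolding borel_prod .
  have fst: "distr (\<mu>1 \<Otimes>\<^sub>M \<mu>2) borel fst = \<mu>1"
    using M2.distr_pair_fst[of \<mu>1] s by (simp cong: distr_cong)
  have "distr (\<mu>1 \<Otimes>\<^sub>M \<mu>2) borel snd = distr (distr (\<mu>2 \<Otimes>\<^sub>M \<mu>1) (\<mu>1 \<Otimes>\<^sub>M \<mu>2) (\<lambda>(x, y). (y, x))) borel snd"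
    by (subst distr_pair_swap) simp
  also have "\<dots> = distr (\<mu>2 \<Otimes>\<^sub>M \<mu>1) borel fst"
    using s by (subst distr_distr) (auto simp: comp_def case_prod_beta measurable_cong_sets[OF refl s(2)[symmetric]])
  also have "\<dots> = \<mu>2"
    using M1.distr_pair_fst[of \<mu>2] s by (simp cong: distr_cong)
  finally have "\<mu>1 \<Otimes>\<^sub>M \<mu>2 \<in> couplings \<mu>1 \<mu>2"
    using fst sets by (auto simp: couplings_def borel_probs_iff P.prob_space_axioms)
  then show ?thesis by auto
qed

lemma OT_cost_le: "\<gamma> \<in> couplings \<mu>1 \<mu>2 \<Longrightarrow> OT_cost c \<mu>1 \<mu>2 \<le> (\<integral>\<^sup>+z. c z \<partial>\<gamma>)"
  unfolding OT_cost_def by (rule INF_lower)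

lemma OT_cost_eq_optimal:
  "\<pi> \<in> optimal_couplings c \<mu>1 \<mu>2 \<Longrightarrow> OT_cost c \<mu>1 \<mu>2 = (\<integral>\<^sup>+z. c z \<partial>\<pi>)"
  unfolding OT_cost_def optimal_couplings_def by (auto intro!: antisym INF_lower INF_greatest)

lemma enn2ereal_eq_ereal: "x < \<infinity> \<Longrightarrow> enn2ereal x = ereal (enn2real x)"
  by (cases x) auto

text \<open>Provides an element of each domain for the potential of an empty
  \<open>F\<close>.\<close>

lemma dirac_in_probs_fin:
  assumes "a \<in> borel_measurable borel" "a x \<noteq> \<infinity>"
  shows "return borel x \<in> probs_fin a"
  using assms by (auto simp: probs_fin_def space_prob_algebra nn_integral_return prob_space_return less_top)

locale transport =
  fixes a1 :: "'a::polish_space \<Rightarrow> ennreal"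
    and a2 :: "'b::polish_space \<Rightarrow> ennreal"
    and c :: "'a \<times> 'b \<Rightarrow> ennreal"
  assumes a1_meas[measurable]: "a1 \<in> borel_measurable borel"
    and a2_meas[measurable]: "a2 \<in> borel_measurable borel"
    and c_lsc: "lower_semicont c"
    and c_le: "c (x1, x2) \<le> a1 x1 + a2 x2"
begin

lemma c_meas[measurable]: "c \<in> borel_measurable borel"
  using c_lsc unfolding lower_semicont_def by (intro borel_measurableI_greater) auto

text \<open>The bound involves only the marginal laws of \<open>f\<close> and \<open>g\<close>, not
  their joint law. It gives finiteness of all costs and controls the closing term of a
  chain.\<close>

lemma cost_le:
  fixes f :: "_ \<Rightarrow> 'a" and g :: "_ \<Rightarrow> 'b"
  assumes f: "f \<in> M \<rightarrow>\<^sub>M borel" and g: "g \<in> M \<rightarrow>\<^sub>M borel"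
  shows "(\<integral>\<^sup>+x. c (f x, g x) \<partial>M) \<le> (\<integral>\<^sup>+x. a1 x \<partial>distr M borel f) + (\<integral>\<^sup>+x. a2 x \<partial>distr M borel g)"
proof -
  note [measurable] = f g
  have "(\<integral>\<^sup>+x. c (f x, g x) \<partial>M) \<le> (\<integral>\<^sup>+x. a1 (f x) + a2 (g x) \<partial>M)"
    by (intro nn_integral_mono c_le)
  also have "\<dots> = (\<integral>\<^sup>+x. a1 x \<partial>distr M borel f) + (\<integral>\<^sup>+x. a2 x \<partial>distr M borel g)"
    by (simp add: nn_integral_add nn_integral_distr)
  finally show ?thesis .
qed

lemma coupling_cost_finite:
  assumes "\<gamma> \<in> couplings \<mu>1 \<mu>2" "\<mu>1 \<in> probs_fin a1" "\<mu>2 \<in> probs_fin a2"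
  shows "(\<integral>\<^sup>+z. c z \<partial>\<gamma>) < \<infinity>"
proof -
  have "sets \<gamma> = sets borel" using couplingsD(1)[OF assms(1)] unfolding borel_probs_iff by auto
  then have "(\<integral>\<^sup>+z. c z \<partial>\<gamma>) \<le> (\<integral>\<^sup>+x. a1 x \<partial>\<mu>1) + (\<integral>\<^sup>+x. a2 x \<partial>\<mu>2)"
    using cost_le[of fst \<gamma> snd] couplingsD[OF assms(1)] by (simp cong: measurable_cong_sets)
  also have "\<dots> < \<infinity>" using assms(2,3) by (simp add: probs_fin_def)
  finally show ?thesis .
qed

lemma OT_cost_finite:
  assumes "\<mu>1 \<in> probs_fin a1" "\<mu>2 \<in> probs_fin a2"
  shows "OT_cost c \<mu>1 \<mu>2 < \<infinity>"
proof -
  obtain \<gamma> where "\<gamma> \<in> couplings \<mu>1 \<mu>2"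
    using couplings_nonempty assms unfolding probs_fin_def by blast
  from order_le_less_trans[OF OT_cost_le[OF this] coupling_cost_finite[OF this assms]] show ?thesis .
qed

section \<open>From total cyclical monotonicity to optimality and monotone marginals\<close>

text \<open>Total cyclical monotonicity is applied to the law of the alternating chain with the
  shift \<open>cyc n\<close>. The shifted pairs have the laws \<open>Q i\<close> for
  \<open>i < n\<close>, and one closing pair remains.\<close>

lemma chain_inequality:
  assumes F: "totally_cyclically_monotone a1 a2 c F"
    and P: "\<And>i. P i \<in> F" and Q: "\<And>i. Q i \<in> borel_probs"
    and Q1: "\<And>i. distr (Q i) borel fst = distr (P (Suc i)) borel fst"
    and Q2: "\<And>i. distr (Q i) borel snd = distr (P i) borel snd"
    and n: "1 \<le> n"
  shows "(\<Sum>i=1..n. \<integral>\<^sup>+z. c z \<partial>P i) \<le> (\<Sum>i=1..<n. \<integral>\<^sup>+z. c z \<partial>Q i) +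
    ((\<integral>\<^sup>+x. a1 x \<partial>distr (P 1) borel fst) + (\<integral>\<^sup>+x. a2 x \<partial>distr (P n) borel snd))"
proof -
  have P': "P i \<in> borel_probs" for i
    using F P[of i] unfolding totally_cyclically_monotone_def probs_fin_prod_def by blast
  let ?S = "Pi\<^sub>M {1..n} (\<lambda>_. borel :: ('a \<times> 'b) measure)"
  obtain \<theta> where \<theta>: "\<theta> \<in> space (prob_algebra ?S)"
    and \<theta>P: "\<And>i. i \<in> {1..n} \<Longrightarrow> distr \<theta> borel (\<lambda>x. x i) = P i"
    and \<theta>Q: "\<And>i. i \<in> {1..<n} \<Longrightarrow> distr \<theta> borel (\<lambda>x. (fst (x (Suc i)), snd (x i))) = Q i"
    using alternating_chain[of P Q n, OF P' Q Q1 Q2 n] by blast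
  have sets_\<theta>: "sets \<theta> = sets ?S" using \<theta> by (auto simp: space_prob_algebra)
  have meas: "f \<in> \<theta> \<rightarrow>\<^sub>M borel \<longleftrightarrow> f \<in> ?S \<rightarrow>\<^sub>M borel" for f :: "_ \<Rightarrow> 'z::topological_space"
    by (simp only: measurable_cong_sets[OF sets_\<theta> refl])
  have comp[measurable]: "(\<lambda>x. x i) \<in> \<theta> \<rightarrow>\<^sub>M borel" if "i \<in> {1..n}" for i
    unfolding meas using that by (rule measurable_component_singleton)
  have cross: "(\<lambda>x. (fst (x i), snd (x j))) \<in> \<theta> \<rightarrow>\<^sub>M borel" if "i \<in> {1..n}" "j \<in> {1..n}" for i j
  proof -
    note [measurable] = comp[OF that(1)] comp[OF that(2)]
    show ?thesis by measurable
  qed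
  have \<sigma>: "cyc n permutes {1..n}" using n by (rule cyc_permutes)
  have \<sigma>_in: "cyc n i \<in> {1..n}" if "i \<in> {1..n}" for i
    using permutes_in_image[OF \<sigma>] that by blast
  have int_sum: "(\<integral>\<^sup>+x. (\<Sum>i=1..n. c (fst (x i), snd (x (\<tau> i)))) \<partial>\<theta>)
      = (\<Sum>i=1..n. \<integral>\<^sup>+x. c (fst (x i), snd (x (\<tau> i))) \<partial>\<theta>)"
    if "\<And>i. i \<in> {1..n} \<Longrightarrow> \<tau> i \<in> {1..n}" for \<tau>
    by (intro nn_integral_sum measurable_compose[OF cross c_meas] that)
  have "(\<Sum>i=1..n. \<integral>\<^sup>+z. c z \<partial>P i) = (\<Sum>i=1..n. \<integral>\<^sup>+x. c (fst (x i), snd (x i)) \<partial>\<theta>)"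
  proof (rule sum.cong[OF refl])
    fix i assume i: "i \<in> {1..n}"
    show "(\<integral>\<^sup>+z. c z \<partial>P i) = (\<integral>\<^sup>+x. c (fst (x i), snd (x i)) \<partial>\<theta>)"
      unfolding \<theta>P[OF i, symmetric] by (subst nn_integral_distr[OF comp[OF i]]) auto
  qed
  also have "\<dots> = (\<integral>\<^sup>+x. (\<Sum>i=1..n. c (fst (x i), snd (x i))) \<partial>\<theta>)"
    using int_sum[of "\<lambda>i. i"] by simp
  also have "\<dots> \<le> (\<integral>\<^sup>+x. (\<Sum>i=1..n. c (fst (x i), snd (x (cyc n i)))) \<partial>\<theta>)"
    using F \<theta> n \<sigma> \<theta>P P unfolding totally_cyclically_monotone_def by simp
  also have "\<dots> = (\<Sum>i=1..n. \<integral>\<^sup>+x. c (fst (x i), snd (x (cyc n i))) \<partial>\<theta>)"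
    by (rule int_sum[OF \<sigma>_in])
  also have "\<dots> = (\<integral>\<^sup>+x. c (fst (x 1), snd (x (cyc n 1))) \<partial>\<theta>)
      + (\<Sum>i=1..<n. \<integral>\<^sup>+x. c (fst (x (Suc i)), snd (x (cyc n (Suc i)))) \<partial>\<theta>)"
    by (rule sum_atLeast1_atMost_shift[OF n])
  also have "(\<Sum>i=1..<n. \<integral>\<^sup>+x. c (fst (x (Suc i)), snd (x (cyc n (Suc i)))) \<partial>\<theta>) = (\<Sum>i=1..<n. \<integral>\<^sup>+z. c z \<partial>Q i)"
  proof (rule sum.cong[OF refl])
    fix i assume i: "i \<in> {1..<n}"
    then have "cyc n (Suc i) = i" and i': "i \<in> {1..n}" "Suc i \<in> {1..n}" by (auto simp: cyc_def)
    then show "(\<integral>\<^sup>+x. c (fst (x (Suc i)), snd (x (cyc n (Suc i)))) \<partial>\<theta>) = (\<integral>\<^sup>+z. c z \<partial>Q i)"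
      unfolding \<theta>Q[OF i, symmetric] by (subst nn_integral_distr[OF cross[OF i'(2,1)]]) auto
  qed
  \<comment> \<open>The joint law of the first component at position 1 and the second at position
    \<open>n\<close> is not prescribed, but its marginals are, and \<open>cost_le\<close> asks for
    no more.\<close>
  also have "(\<integral>\<^sup>+x. c (fst (x 1), snd (x (cyc n 1))) \<partial>\<theta>)
      \<le> (\<integral>\<^sup>+x. a1 x \<partial>distr (P 1) borel fst) + (\<integral>\<^sup>+x. a2 x \<partial>distr (P n) borel snd)"
  proof -
    have 1: "1 \<in> {1..n}" "n \<in> {1..n}" using n by auto
    have "distr \<theta> borel (\<lambda>x. fst (x 1)) = distr (P 1) borel fst"
      unfolding \<theta>P[OF 1(1), symmetric] distr_compose[OF refl comp[OF 1(1)] borel_measurable_fst] ..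
    moreover have "distr \<theta> borel (\<lambda>x. snd (x n)) = distr (P n) borel snd"
      unfolding \<theta>P[OF 1(2), symmetric] distr_compose[OF refl comp[OF 1(2)] borel_measurable_snd] ..
    moreover have "cyc n 1 = n" by (simp add: cyc_def)
    ultimately show ?thesis
      using cost_le[of "\<lambda>x. fst (x 1)" \<theta> "\<lambda>x. snd (x n)"]
        measurable_compose[OF comp[OF 1(1)] borel_measurable_fst]
        measurable_compose[OF comp[OF 1(2)] borel_measurable_snd] by metis
  qed
  finally show ?thesis by (simp add: add.commute)
qed

text \<open>The \<open>\<gamma> i\<close> cannot be glued together with the \<open>\<pi> i\<close> along a closed cycle. Following
  the permutation for \<open>n\<close> steps along an open chain instead costs an error bounded
  independently of \<open>n\<close>, which disappears after division by \<open>n\<close>.\<close>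

lemma cyclic_rearrangement:
  fixes k :: nat
  assumes F: "totally_cyclically_monotone a1 a2 c F"
    and \<sigma>: "\<sigma> permutes {1..k}"
    and \<pi>: "\<And>i. i \<in> {1..k} \<Longrightarrow> \<pi> i \<in> F"
    and \<gamma>: "\<And>i. i \<in> {1..k} \<Longrightarrow> \<gamma> i \<in> couplings (distr (\<pi> i) borel fst) (distr (\<pi> (\<sigma> i)) borel snd)"
  shows "(\<Sum>i=1..k. \<integral>\<^sup>+z. c z \<partial>\<pi> i) \<le> (\<Sum>i=1..k. \<integral>\<^sup>+z. c z \<partial>\<gamma> i)"
proof -
  \<comment> \<open>\<open>\<gamma> i\<close> links the second marginal of
    \<open>\<pi> (\<sigma> i)\<close> to the first marginal of \<open>\<pi> i\<close>, so a chain
    must visit the indices along the inverse of \<open>\<sigma>\<close>.\<close>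
  define \<tau> where "\<tau> = inv \<sigma>"
  have \<tau>: "(\<tau> ^^ n) permutes {1..k}" for n
    unfolding \<tau>_def by (intro permutes_funpow permutes_inv \<sigma>)
  have \<tau>_in: "(\<tau> ^^ n) i \<in> {1..k}" if "i \<in> {1..k}" for n i
    using permutes_in_image[OF \<tau>] that by blast
  have \<sigma>\<tau>: "\<sigma> ((\<tau> ^^ Suc n) i) = (\<tau> ^^ n) i" for n i
    using permutes_inverses(1)[OF \<sigma>] by (simp add: \<tau>_def)
  have reindex: "(\<Sum>i=1..k. h ((\<tau> ^^ n) i)) = (\<Sum>i=1..k. h i)" for h :: "nat \<Rightarrow> ennreal" and n
    using sum.permute[OF \<tau>, of h n] by (simp add: comp_def)
  define A where "A i = (\<integral>\<^sup>+x. a1 x \<partial>distr (\<pi> i) borel fst)" for i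
  define B where "B i = (\<integral>\<^sup>+x. a2 x \<partial>distr (\<pi> i) borel snd)" for i
  define p where "p i = (\<integral>\<^sup>+z. c z \<partial>\<pi> i)" for i
  define q where "q i = (\<integral>\<^sup>+z. c z \<partial>\<gamma> i)" for i
  have fin: "A i < \<infinity>" "B i < \<infinity>" if "i \<in> {1..k}" for i
  proof -
    have "\<pi> i \<in> probs_fin_prod a1 a2"
      using F \<pi>[OF that] unfolding totally_cyclically_monotone_def by blast
    then show "A i < \<infinity>" "B i < \<infinity>" by (auto simp: probs_fin_prod_def probs_fin_def A_def B_def)
  qed
  have chain: "(\<Sum>j=1..n. p ((\<tau> ^^ j) i)) \<le> (\<Sum>j=1..<n. q ((\<tau> ^^ Suc j) i)) + (A ((\<tau> ^^ 1) i) + B ((\<tau> ^^ n) i))"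
    if i: "i \<in> {1..k}" and "1 \<le> n" for i n
    unfolding p_def q_def A_def B_def
  proof (rule chain_inequality[OF F _ _ _ _ \<open>1 \<le> n\<close>])
    fix j
    have in_k: "(\<tau> ^^ j) i \<in> {1..k}" "(\<tau> ^^ Suc j) i \<in> {1..k}" using \<tau>_in[OF i] by blast+
    show "\<pi> ((\<tau> ^^ j) i) \<in> F" by (rule \<pi>[OF in_k(1)])
    note * = couplingsD[OF \<gamma>[OF in_k(2)]]
    show "\<gamma> ((\<tau> ^^ Suc j) i) \<in> borel_probs" by (rule *)
    show "distr (\<gamma> ((\<tau> ^^ Suc j) i)) borel fst = distr (\<pi> ((\<tau> ^^ Suc j) i)) borel fst" by (rule *)
    show "distr (\<gamma> ((\<tau> ^^ Suc j) i)) borel snd = distr (\<pi> ((\<tau> ^^ j) i)) borel snd"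
      using *(3) unfolding \<sigma>\<tau> .
  qed
  \<comment> \<open>At each fixed time \<open>j\<close> the chains started at all \<open>k\<close>
    indices occupy every index exactly once. Summing over starting points therefore yields
    \<open>n\<close> full sums of \<open>p\<close> against \<open>n - 1\<close> full sums of
    \<open>q\<close>.\<close>
  have "(\<Sum>i=1..k. p i) \<le> (\<Sum>i=1..k. q i)"
  proof (rule ennreal_le_of_linear_growth)
    fix n :: nat assume n: "1 \<le> n"
    have "of_nat n * (\<Sum>i=1..k. p i) = (\<Sum>j=1..n. \<Sum>i=1..k. p ((\<tau> ^^ j) i))"
      unfolding reindex by simp
    also have "\<dots> = (\<Sum>i=1..k. \<Sum>j=1..n. p ((\<tau> ^^ j) i))"
      by (rule sum.swap)
    also have "\<dots> \<le> (\<Sum>i=1..k. (\<Sum>j=1..<n. q ((\<tau> ^^ Suc j) i)) + (A ((\<tau> ^^ 1) i) + B ((\<tau> ^^ n) i)))"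
      by (intro sum_mono chain n)
    also have "\<dots> = (\<Sum>i=1..k. \<Sum>j=1..<n. q ((\<tau> ^^ Suc j) i))
        + ((\<Sum>i=1..k. A ((\<tau> ^^ 1) i)) + (\<Sum>i=1..k. B ((\<tau> ^^ n) i)))"
      by (simp only: sum.distrib)
    also have "(\<Sum>i=1..k. \<Sum>j=1..<n. q ((\<tau> ^^ Suc j) i)) = (\<Sum>j=1..<n. \<Sum>i=1..k. q ((\<tau> ^^ Suc j) i))"
      by (rule sum.swap)
    also have "\<dots> = of_nat (n - 1) * (\<Sum>i=1..k. q i)"
      unfolding reindex by simp
    finally show "of_nat n * (\<Sum>i=1..k. p i)
        \<le> of_nat (n - 1) * (\<Sum>i=1..k. q i) + ((\<Sum>i=1..k. A i) + (\<Sum>i=1..k. B i))"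
      unfolding reindex .
  next
    show "(\<Sum>i=1..k. A i) + (\<Sum>i=1..k. B i) < \<infinity>"
      using fin by (simp add: ennreal_sum_less_top)
  qed
  then show ?thesis by (simp add: p_def q_def)
qed

text \<open>The rearrangement inequality with a single index: a competitor with the marginals of
  \<open>\<pi>\<close> is a link from \<open>\<pi>\<close> to itself.\<close>

lemma optimal_of_totally_cyclically_monotone:
  assumes F: "totally_cyclically_monotone a1 a2 c F" and \<pi>: "\<pi> \<in> F"
  shows "\<pi> \<in> optimal_couplings c (distr \<pi> borel fst) (distr \<pi> borel snd)"
proof -
  have "\<pi> \<in> borel_probs"
    using F \<pi> unfolding totally_cyclically_monotone_def probs_fin_prod_def by blast
  moreover have "(\<integral>\<^sup>+z. c z \<partial>\<pi>) \<le> (\<integral>\<^sup>+z. c z \<partial>\<gamma>)"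
    if "\<gamma> \<in> couplings (distr \<pi> borel fst) (distr \<pi> borel snd)" for \<gamma>
    using cyclic_rearrangement[OF F permutes_id, of 1 "\<lambda>_. \<pi>" "\<lambda>_. \<gamma>"] \<pi> that by simp
  ultimately show ?thesis by (auto simp: optimal_couplings_def couplings_def)
qed

text \<open>By optimality the unpermuted costs are integrals against the \<open>\<pi> i\<close>. The
  permuted costs are infima over couplings, and the rearrangement inequality bounds every joint
  choice of these, as \<open>sum_INF_ge\<close> requires.\<close>

lemma cyclically_monotone_marginals:
  assumes F: "totally_cyclically_monotone a1 a2 c F"
  shows "cyclically_monotone a1 a2 c ((\<lambda>\<pi>. (distr \<pi> borel fst, distr \<pi> borel snd)) ` F)"
  unfolding cyclically_monotone_def
proof (intro conjI allI impI)
  show "(\<lambda>\<pi>. (distr \<pi> borel fst, distr \<pi> borel snd)) ` F \<subseteq> probs_fin a1 \<times> probs_fin a2"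
    using F by (auto simp: totally_cyclically_monotone_def probs_fin_prod_def)
  fix k :: nat and \<sigma> \<mu>1 \<mu>2
  assume \<sigma>: "\<sigma> permutes {1..k}"
    and "\<forall>i\<in>{1..k}. (\<mu>1 i, \<mu>2 i) \<in> (\<lambda>\<pi>. (distr \<pi> borel fst, distr \<pi> borel snd)) ` F"
  then have "\<forall>i\<in>{1..k}. \<exists>\<pi>. \<pi> \<in> F \<and> \<mu>1 i = distr \<pi> borel fst \<and> \<mu>2 i = distr \<pi> borel snd" by auto
  then obtain \<pi> where \<pi>: "\<And>i. i \<in> {1..k} \<Longrightarrow> \<pi> i \<in> F"
    and \<mu>1: "\<And>i. i \<in> {1..k} \<Longrightarrow> \<mu>1 i = distr (\<pi> i) borel fst"
    and \<mu>2: "\<And>i. i \<in> {1..k} \<Longrightarrow> \<mu>2 i = distr (\<pi> i) borel snd"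
    by metis
  have \<sigma>_in: "\<sigma> i \<in> {1..k}" if "i \<in> {1..k}" for i
    using permutes_in_image[OF \<sigma>] that by blast
  have "(\<Sum>i=1..k. OT_cost c (\<mu>1 i) (\<mu>2 i)) = (\<Sum>i=1..k. \<integral>\<^sup>+z. c z \<partial>\<pi> i)"
    using OT_cost_eq_optimal[OF optimal_of_totally_cyclically_monotone[OF F \<pi>]] \<mu>1 \<mu>2
    by (intro sum.cong) auto
  also have "\<dots> \<le> (\<Sum>i=1..k. OT_cost c (\<mu>1 i) (\<mu>2 (\<sigma> i)))"
    unfolding OT_cost_def
  proof (rule sum_INF_ge)
    fix \<gamma> assume "\<And>i. i \<in> {1..k} \<Longrightarrow> \<gamma> i \<in> couplings (\<mu>1 i) (\<mu>2 (\<sigma> i))"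
    then show "(\<Sum>i=1..k. \<integral>\<^sup>+z. c z \<partial>\<pi> i) \<le> (\<Sum>i=1..k. \<integral>\<^sup>+z. c z \<partial>\<gamma> i)"
      using \<mu>1 \<mu>2[OF \<sigma>_in] by (intro cyclic_rearrangement[OF F \<sigma> \<pi>]) auto
  qed simp
  finally show "(\<Sum>i=1..k. OT_cost c (\<mu>1 i) (\<mu>2 i)) \<le> (\<Sum>i=1..k. OT_cost c (\<mu>1 i) (\<mu>2 (\<sigma> i)))" .
qed

section \<open>The converse implication\<close>

text \<open>Under \<open>\<theta>\<close> the unpermuted terms equal transport costs by optimality,
  while each permuted term is the cost of some coupling and hence at least a transport cost;
  monotonicity of \<open>G\<close> compares the transport costs.\<close>

lemma totally_cyclically_monotone_optimal:
  assumes G: "cyclically_monotone a1 a2 c G"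
  shows "totally_cyclically_monotone a1 a2 c
    {\<pi> \<in> probs_fin_prod a1 a2. \<pi> \<in> optimal_couplings c (distr \<pi> borel fst) (distr \<pi> borel snd) \<and>
      (distr \<pi> borel fst, distr \<pi> borel snd) \<in> G}" (is "totally_cyclically_monotone a1 a2 c ?F")
  unfolding totally_cyclically_monotone_def
proof (intro conjI allI impI ballI)
  fix N :: nat and \<theta> \<sigma>
  let ?S = "Pi\<^sub>M {1..N} (\<lambda>_. borel :: ('a \<times> 'b) measure)"
  assume \<theta>: "\<theta> \<in> space (prob_algebra ?S)" and "1 \<le> N"
    and \<theta>F: "\<forall>n\<in>{1..N}. distr \<theta> borel (\<lambda>x. x n) \<in> ?F" and \<sigma>: "\<sigma> permutes {1..N}"
  have sets_\<theta>: "sets \<theta> = sets ?S" and \<theta>_prob: "prob_space \<theta>" using \<theta> by (auto simp: space_prob_algebra)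
  have \<sigma>_in: "\<sigma> i \<in> {1..N}" if "i \<in> {1..N}" for i
    using permutes_in_image[OF \<sigma>] that by blast
  have comp: "(\<lambda>x. x i) \<in> \<theta> \<rightarrow>\<^sub>M borel" if "i \<in> {1..N}" for i
    unfolding measurable_cong_sets[OF sets_\<theta> refl] using that by (rule measurable_component_singleton)
  have cross: "(\<lambda>x. (fst (x i), snd (x j))) \<in> \<theta> \<rightarrow>\<^sub>M borel" if "i \<in> {1..N}" "j \<in> {1..N}" for i j
  proof -
    note [measurable] = comp[OF that(1)] comp[OF that(2)]
    show ?thesis by measurable
  qed
  define \<pi> where "\<pi> i = distr \<theta> borel (\<lambda>x. x i)" for i
  define \<mu>1 where "\<mu>1 i = distr (\<pi> i) borel fst" for i
  define \<mu>2 where "\<mu>2 i = distr (\<pi> i) borel snd" for i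
  have \<mu>1: "distr \<theta> borel (\<lambda>x. fst (x i)) = \<mu>1 i" if "i \<in> {1..N}" for i
    unfolding \<mu>1_def \<pi>_def distr_compose[OF refl comp[OF that] borel_measurable_fst] ..
  have \<mu>2: "distr \<theta> borel (\<lambda>x. snd (x i)) = \<mu>2 i" if "i \<in> {1..N}" for i
    unfolding \<mu>2_def \<pi>_def distr_compose[OF refl comp[OF that] borel_measurable_snd] ..
  have int_sum: "(\<integral>\<^sup>+x. (\<Sum>i=1..N. c (fst (x i), snd (x (\<tau> i)))) \<partial>\<theta>)
      = (\<Sum>i=1..N. \<integral>\<^sup>+x. c (fst (x i), snd (x (\<tau> i))) \<partial>\<theta>)"
    if "\<And>i. i \<in> {1..N} \<Longrightarrow> \<tau> i \<in> {1..N}" for \<tau>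
    by (intro nn_integral_sum measurable_compose[OF cross c_meas] that)
  have "(\<integral>\<^sup>+x. (\<Sum>i=1..N. c (fst (x i), snd (x i))) \<partial>\<theta>) = (\<Sum>i=1..N. \<integral>\<^sup>+x. c (fst (x i), snd (x i)) \<partial>\<theta>)"
    using int_sum[of "\<lambda>i. i"] by simp
  also have "\<dots> = (\<Sum>i=1..N. OT_cost c (\<mu>1 i) (\<mu>2 i))"
  proof (rule sum.cong[OF refl])
    fix i assume i: "i \<in> {1..N}"
    have "\<pi> i \<in> optimal_couplings c (\<mu>1 i) (\<mu>2 i)"
      using \<theta>F i by (auto simp: \<pi>_def \<mu>1_def \<mu>2_def)
    from OT_cost_eq_optimal[OF this]
    show "(\<integral>\<^sup>+x. c (fst (x i), snd (x i)) \<partial>\<theta>) = OT_cost c (\<mu>1 i) (\<mu>2 i)"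
      unfolding \<pi>_def by (subst (asm) nn_integral_distr[OF comp[OF i]]) auto
  qed
  also have "\<dots> \<le> (\<Sum>i=1..N. OT_cost c (\<mu>1 i) (\<mu>2 (\<sigma> i)))"
  proof (rule G[unfolded cyclically_monotone_def, THEN conjunct2, rule_format, OF \<open>1 \<le> N\<close> \<sigma>])
    show "(\<mu>1 i, \<mu>2 i) \<in> G" if "i \<in> {1..N}" for i
      using bspec[OF \<theta>F that] by (simp add: \<mu>1_def \<mu>2_def \<pi>_def)
  qed
  also have "\<dots> \<le> (\<Sum>i=1..N. \<integral>\<^sup>+x. c (fst (x i), snd (x (\<sigma> i))) \<partial>\<theta>)"
  proof (rule sum_mono)
    fix i assume i: "i \<in> {1..N}"
    let ?f = "\<lambda>x. (fst (x i), snd (x (\<sigma> i)))"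
    note f = cross[OF i \<sigma>_in[OF i]]
    have "distr \<theta> borel ?f \<in> couplings (\<mu>1 i) (\<mu>2 (\<sigma> i))"
      unfolding couplings_def borel_probs_iff \<mu>1[OF i, symmetric] \<mu>2[OF \<sigma>_in[OF i], symmetric]
      using distr_compose[OF refl f borel_measurable_fst] distr_compose[OF refl f borel_measurable_snd]
        prob_space.prob_space_distr[OF \<theta>_prob f] by simp
    from OT_cost_le[OF this, of c]
    show "OT_cost c (\<mu>1 i) (\<mu>2 (\<sigma> i)) \<le> (\<integral>\<^sup>+x. c (?f x) \<partial>\<theta>)"
      by (subst (asm) nn_integral_distr[OF f]) auto
  qed
  also have "\<dots> = (\<integral>\<^sup>+x. (\<Sum>i=1..N. c (fst (x i), snd (x (\<sigma> i)))) \<partial>\<theta>)"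
    by (rule int_sum[OF \<sigma>_in, symmetric])
  finally show "(\<integral>\<^sup>+x. (\<Sum>i=1..N. c (fst (x i), snd (x i))) \<partial>\<theta>)
      \<le> (\<integral>\<^sup>+x. (\<Sum>i=1..N. c (fst (x i), snd (x (\<sigma> i)))) \<partial>\<theta>)" .
qed auto

section \<open>The concave potential\<close>

lemma OT_cost_ennreal:
  assumes "\<mu>1 \<in> probs_fin a1" "\<mu>2 \<in> probs_fin a2"
  shows "OT_cost c \<mu>1 \<mu>2 = ennreal (enn2real (OT_cost c \<mu>1 \<mu>2))"
  using OT_cost_finite[OF assms] by simp

text \<open>Supplies the hypothesis of \<open>rockafellar\<close>: the shift
  \<open>cyc (Suc n)\<close> turns the permutation inequality into one for chains, and finiteness of
  the costs moves it to the reals.\<close>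

lemma cyclically_monotone_chain:
  assumes G: "cyclically_monotone a1 a2 c G" and m: "\<And>i. i \<le> n \<Longrightarrow> m i \<in> G"
  defines "C \<equiv> \<lambda>s t. enn2real (OT_cost c s t)"
  shows "(\<Sum>i\<le>n. C (fst (m i)) (snd (m i))) \<le> C (fst (m 0)) (snd (m n)) + (\<Sum>i<n. C (fst (m (Suc i))) (snd (m i)))"
proof -
  let ?O = "\<lambda>i j. OT_cost c (fst (m i)) (snd (m j))"
  have O: "?O i j = ennreal (C (fst (m i)) (snd (m j)))" if "i \<le> n" "j \<le> n" for i j
  proof -
    have "m i \<in> probs_fin a1 \<times> probs_fin a2" "m j \<in> probs_fin a1 \<times> probs_fin a2"
      using G m that unfolding cyclically_monotone_def by blast+
    then show ?thesis unfolding C_def by (intro OT_cost_ennreal) auto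
  qed
  have C: "0 \<le> C s t" for s t by (simp add: C_def)
  \<comment> \<open>Chains are indexed from 0 and permutations act on \<open>{1..Suc n}\<close>, so
    position \<open>i\<close> carries the pair \<open>m (i - 1)\<close>.\<close>
  have "(\<Sum>i=1..Suc n. ?O (i - 1) (i - 1)) \<le> (\<Sum>i=1..Suc n. ?O (i - 1) (cyc (Suc n) i - 1))"
    by (rule G[unfolded cyclically_monotone_def, THEN conjunct2, rule_format, OF _ cyc_permutes])
      (auto intro: m)
  also have "\<dots> = ?O 0 n + (\<Sum>i=1..<Suc n. ?O i (i - 1))"
    by (subst sum_atLeast1_atMost_shift) (auto simp: cyc_def intro!: sum.cong)
  also have "(\<Sum>i=1..<Suc n. ?O i (i - 1)) = (\<Sum>i<n. ?O (Suc i) i)"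
    using sum.shift_bounds_Suc_ivl[of "\<lambda>i. ?O i (i - 1)" 0 n] by (simp add: lessThan_atLeast0)
  also have "(\<Sum>i=1..Suc n. ?O (i - 1) (i - 1)) = (\<Sum>i\<le>n. ?O i i)"
    by (simp add: sum.atLeast1_atMost_eq lessThan_Suc_atMost del: sum.cl_ivl_Suc)
  also have "(\<Sum>i\<le>n. ?O i i) = ennreal (\<Sum>i\<le>n. C (fst (m i)) (snd (m i)))"
    by (subst sum_ennreal[symmetric]) (auto simp: O C)
  also have "(\<Sum>i<n. ?O (Suc i) i) = ennreal (\<Sum>i<n. C (fst (m (Suc i))) (snd (m i)))"
    by (subst sum_ennreal[symmetric]) (auto simp: O C)
  finally show ?thesis
    by (simp add: O C sum_nonneg flip: ennreal_plus)
qed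

text \<open>The law of \<open>(x1, x2)\<close> is optimal, so its cost equals a transport cost; the
  law of \<open>(x1', x2)\<close> is merely a coupling, so its cost is at least a transport cost. It
  enters with a minus sign, which gives the upper bound.\<close>

lemma superdiff_integral_le:
  fixes \<theta> :: "('a \<times> 'b \<times> 'a) measure"
  assumes \<pi>: "\<pi> \<in> optimal_couplings c (distr \<pi> borel fst) (distr \<pi> borel snd)" "\<pi> \<in> probs_fin_prod a1 a2"
    and \<theta>: "\<theta> \<in> borel_probs" and \<theta>\<pi>: "distr \<theta> borel (\<lambda>(x1, x2, x1'). (x1, x2)) = \<pi>"
    and \<mu>: "distr \<theta> borel (\<lambda>(x1, x2, x1'). x1') \<in> probs_fin a1"
  shows "(\<integral>(x1, x2, x1'). enn2real (c (x1, x2)) - enn2real (c (x1', x2)) \<partial>\<theta>)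
    \<le> enn2real (OT_cost c (distr \<pi> borel fst) (distr \<pi> borel snd))
      - enn2real (OT_cost c (distr \<theta> borel (\<lambda>(x1, x2, x1'). x1')) (distr \<pi> borel snd))"
proof -
  define \<mu>' where "\<mu>' = distr \<theta> borel (\<lambda>(x1, x2, x1'). x1')"
  define \<mu>1 where "\<mu>1 = distr \<pi> borel fst"
  define \<mu>2 where "\<mu>2 = distr \<pi> borel snd"
  have sets_\<theta>: "sets \<theta> = sets borel" and \<theta>_prob: "prob_space \<theta>" using \<theta> unfolding borel_probs_iff by auto
  define f where "f z = (fst z, fst (snd z))" for z :: "'a \<times> 'b \<times> 'a"
  define g where "g z = (snd (snd z), fst (snd z))" for z :: "'a \<times> 'b \<times> 'a"
  have f: "f \<in> \<theta> \<rightarrow>\<^sub>M borel" and g: "g \<in> \<theta> \<rightarrow>\<^sub>M borel"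
    unfolding measurable_cong_sets[OF sets_\<theta> refl] f_def g_def
    by (intro borel_measurable_continuous_onI continuous_intros)+
  define \<gamma> where "\<gamma> = distr \<theta> borel g"
  have \<pi>_eq: "\<pi> = distr \<theta> borel f"
    unfolding \<theta>\<pi>[symmetric] f_def case_prod_beta' ..
  have fin: "\<mu>1 \<in> probs_fin a1" "\<mu>2 \<in> probs_fin a2" "\<mu>' \<in> probs_fin a1"
    using \<pi>(2) \<mu> by (auto simp: probs_fin_prod_def \<mu>1_def \<mu>2_def \<mu>'_def)
  have \<gamma>: "\<gamma> \<in> couplings \<mu>' \<mu>2"
    unfolding couplings_def borel_probs_iff \<gamma>_def \<mu>'_def \<mu>2_def \<pi>_eq
    using prob_space.prob_space_distr[OF \<theta>_prob g]
    by (simp add: distr_compose[OF refl g borel_measurable_fst] distr_compose[OF refl g borel_measurable_snd]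
      distr_compose[OF refl f borel_measurable_snd], simp add: f_def g_def case_prod_beta')
  have \<pi>': "\<pi> \<in> couplings \<mu>1 \<mu>2"
    using \<pi>(1) by (simp add: optimal_couplings_def \<mu>1_def \<mu>2_def)
  have int_f: "(\<integral>\<^sup>+z. c (f z) \<partial>\<theta>) = (\<integral>\<^sup>+z. c z \<partial>\<pi>)"
    unfolding \<pi>_eq by (subst nn_integral_distr[OF f]) auto
  have int_g: "(\<integral>\<^sup>+z. c (g z) \<partial>\<theta>) = (\<integral>\<^sup>+z. c z \<partial>\<gamma>)"
    unfolding \<gamma>_def by (subst nn_integral_distr[OF g]) auto
  note cf = measurable_compose[OF f c_meas] and cg = measurable_compose[OF g c_meas]
  note fin_f = coupling_cost_finite[OF \<pi>' fin(1,2), folded int_f]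
    and fin_g = coupling_cost_finite[OF \<gamma> fin(3,2), folded int_g]
  have "(\<integral>(x1, x2, x1'). enn2real (c (x1, x2)) - enn2real (c (x1', x2)) \<partial>\<theta>)
      = (\<integral>z. enn2real (c (f z)) - enn2real (c (g z)) \<partial>\<theta>)"
    by (simp add: f_def g_def case_prod_beta')
  also have "\<dots> = enn2real (\<integral>\<^sup>+z. c z \<partial>\<pi>) - enn2real (\<integral>\<^sup>+z. c z \<partial>\<gamma>)"
    using enn2real_integral[OF cf fin_f] enn2real_integral[OF cg fin_g]
    by (simp add: int_f int_g)
  also have "\<dots> \<le> enn2real (OT_cost c \<mu>1 \<mu>2) - enn2real (OT_cost c \<mu>' \<mu>2)"
  proof (rule diff_mono)
    show "enn2real (\<integral>\<^sup>+z. c z \<partial>\<pi>) \<le> enn2real (OT_cost c \<mu>1 \<mu>2)"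
      using OT_cost_eq_optimal[OF \<pi>(1)] by (simp add: \<mu>1_def \<mu>2_def)
    show "enn2real (OT_cost c \<mu>' \<mu>2) \<le> enn2real (\<integral>\<^sup>+z. c z \<partial>\<gamma>)"
      using OT_cost_le[OF \<gamma>] coupling_cost_finite[OF \<gamma> fin(3,2)] by (intro enn2real_mono) auto
  qed
  finally show ?thesis unfolding \<mu>1_def \<mu>2_def \<mu>'_def .
qed

lemma concave_potential_exists:
  assumes F: "totally_cyclically_monotone a1 a2 c F"
    and ne: "\<exists>x1. a1 x1 \<noteq> \<infinity>" "\<exists>x2. a2 x2 \<noteq> \<infinity>"
  shows "\<exists>\<phi>. OT_concave a1 a2 c \<phi> \<and> F \<subseteq> total_superdiff a1 a2 c \<phi>"
proof (cases "F = {}")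
  case True
  \<comment> \<open>With no pair from which to start a chain, the cost to one fixed measure
    \<open>\<nu>2\<close> serves as the potential.\<close>
  from ne obtain \<nu>1 \<nu>2 where \<nu>: "\<nu>1 \<in> probs_fin a1" "\<nu>2 \<in> probs_fin a2"
    using dirac_in_probs_fin[OF a1_meas] dirac_in_probs_fin[OF a2_meas] by metis
  have "OT_concave a1 a2 c (\<lambda>\<mu>. enn2ereal (OT_cost c \<mu> \<nu>2))"
    unfolding OT_concave_def
  proof (intro conjI)
    show "\<forall>\<mu>1\<in>probs_fin a1. enn2ereal (OT_cost c \<mu>1 \<nu>2) < \<infinity>"
      using OT_cost_finite[OF _ \<nu>(2)] by (simp add: enn2ereal_eq_ereal)
    show "\<exists>\<mu>1\<in>probs_fin a1. enn2ereal (OT_cost c \<mu>1 \<nu>2) \<noteq> -\<infinity>"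
      using \<nu>(1) by auto
    show "\<exists>A\<subseteq>probs_fin a2 \<times> (UNIV :: real set). \<forall>\<mu>1\<in>probs_fin a1.
        enn2ereal (OT_cost c \<mu>1 \<nu>2) = (INF (\<mu>2, \<alpha>)\<in>A. enn2ereal (OT_cost c \<mu>1 \<mu>2) - ereal \<alpha>)"
      using \<nu>(2) by (intro exI[of _ "{(\<nu>2, 0)}"]) (auto simp: zero_ereal_def[symmetric])
  qed
  with True show ?thesis by blast
next
  case False
  define G where "G = (\<lambda>\<pi>. (distr \<pi> borel fst, distr \<pi> borel snd)) ` F"
  define C where "C s t = enn2real (OT_cost c s t)" for s t
  have G: "cyclically_monotone a1 a2 c G"
    unfolding G_def by (rule cyclically_monotone_marginals[OF F])
  then have G_sub: "G \<subseteq> probs_fin a1 \<times> probs_fin a2" by (simp add: cyclically_monotone_def)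
  have G_ne: "G \<noteq> {}" using False by (simp add: G_def)
  obtain A \<phi> where A: "A \<subseteq> snd ` G \<times> (UNIV :: real set)"
    and \<phi>: "\<And>s. \<phi> s = (INF (t, \<alpha>)\<in>A. ereal (C s t) - ereal \<alpha>)"
    and \<phi>_fin: "\<And>s. \<phi> s < \<infinity>" and \<phi>_ne: "\<exists>s\<in>fst ` G. \<phi> s \<noteq> -\<infinity>"
    and super: "\<And>s t s'. (s, t) \<in> G \<Longrightarrow> ereal (C s t - C s' t) \<le> \<phi> s - \<phi> s'"
    using rockafellar[OF G_ne, of C] cyclically_monotone_chain[OF G] unfolding C_def by blast
  have "OT_concave a1 a2 c \<phi>"
    unfolding OT_concave_def
  proof (intro conjI exI ballI)
    show "\<phi> \<mu>1 < \<infinity>" for \<mu>1 by (rule \<phi>_fin)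
    show "\<exists>\<mu>1\<in>probs_fin a1. \<phi> \<mu>1 \<noteq> -\<infinity>" using \<phi>_ne G_sub by auto
    have "snd ` G \<subseteq> probs_fin a2" using G_sub by auto
    with A show A2: "A \<subseteq> probs_fin a2 \<times> UNIV" by blast
    \<comment> \<open>The construction used real-valued costs \<open>C\<close>; these agree with the
      extended ones wherever both measures have finite moments.\<close>
    fix \<mu>1 assume \<mu>1: "\<mu>1 \<in> probs_fin a1"
    show "\<phi> \<mu>1 = (INF (\<mu>2, \<alpha>)\<in>A. enn2ereal (OT_cost c \<mu>1 \<mu>2) - ereal \<alpha>)"
      unfolding \<phi>
    proof (rule INF_cong[OF refl])
      fix z assume "z \<in> A"
      with A2 have "fst z \<in> probs_fin a2" by auto
      then have "enn2ereal (OT_cost c \<mu>1 (fst z)) = ereal (C \<mu>1 (fst z))"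
        unfolding C_def using OT_cost_finite[OF \<mu>1] by (intro enn2ereal_eq_ereal) simp
      then show "(case z of (t, \<alpha>) \<Rightarrow> ereal (C \<mu>1 t) - ereal \<alpha>)
          = (case z of (\<mu>2, \<alpha>) \<Rightarrow> enn2ereal (OT_cost c \<mu>1 \<mu>2) - ereal \<alpha>)"
        by (simp add: case_prod_beta')
    qed
  qed
  moreover have "F \<subseteq> total_superdiff a1 a2 c \<phi>"
  proof
    fix \<pi> assume \<pi>F: "\<pi> \<in> F"
    have \<pi>: "\<pi> \<in> probs_fin_prod a1 a2"
      using F \<pi>F unfolding totally_cyclically_monotone_def by blast
    show "\<pi> \<in> total_superdiff a1 a2 c \<phi>"
      unfolding total_superdiff_def
    proof (intro CollectI conjI ballI impI \<pi>)
      fix \<theta> :: "('a \<times> 'b \<times> 'a) measure"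
      assume \<theta>: "\<theta> \<in> borel_probs" "distr \<theta> borel (\<lambda>(x1, x2, x1'). (x1, x2)) = \<pi>"
        "distr \<theta> borel (\<lambda>(x1, x2, x1'). x1') \<in> probs_fin a1"
      have sets_\<theta>: "sets \<theta> = sets borel" using \<theta>(1) unfolding borel_probs_iff by auto
      have f: "(\<lambda>(x1, x2, x1'). (x1, x2)) \<in> borel \<rightarrow>\<^sub>M (borel :: ('a \<times> 'b) measure)"
        unfolding case_prod_beta' by (intro borel_measurable_continuous_onI continuous_intros)
      have fst_\<theta>: "distr \<theta> borel (\<lambda>(x1, x2, x1'). x1) = distr \<pi> borel fst"
        unfolding \<theta>(2)[symmetric] distr_compose[OF sets_\<theta> f borel_measurable_fst]
        by (simp add: case_prod_beta')
      have "(distr \<pi> borel fst, distr \<pi> borel snd) \<in> G" using \<pi>F by (auto simp: G_def)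
      \<comment> \<open>The integral is at most a difference of transport costs to the second
        marginal of \<open>\<pi>\<close>, which in turn is at most the difference of
        potentials.\<close>
      from order_trans[OF _ super[OF this]]
        superdiff_integral_le[OF optimal_of_totally_cyclically_monotone[OF F \<pi>F] \<pi> \<theta>]
      show "ereal (\<integral>(x1, x2, x1'). enn2real (c (x1, x2)) - enn2real (c (x1', x2)) \<partial>\<theta>)
          \<le> \<phi> (distr \<theta> borel (\<lambda>(x1, x2, x1'). x1)) - \<phi> (distr \<theta> borel (\<lambda>(x1, x2, x1'). x1'))"
        unfolding fst_\<theta> C_def by simp
    qed
  qed
  ultimately show ?thesis by blast
qed

end

theorem proposition3p8:
  fixes a1 :: "'a::polish_space \<Rightarrow> ennreal"
    and a2 :: "'b::polish_space \<Rightarrow> ennreal"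
    and c :: "'a \<times> 'b \<Rightarrow> ennreal"
  assumes "a1 \<in> borel_measurable borel" and "\<exists>x1. a1 x1 \<noteq> \<infinity>"
    and "a2 \<in> borel_measurable borel" and "\<exists>x2. a2 x2 \<noteq> \<infinity>"
    and "lower_semicont c"
    and "\<forall>x1 x2. c (x1, x2) \<le> a1 x1 + a2 x2"
  shows "(\<forall>F. totally_cyclically_monotone a1 a2 c F \<longrightarrow>
            (\<forall>\<pi>\<in>F. \<pi> \<in> optimal_couplings c (distr \<pi> borel fst) (distr \<pi> borel snd)) \<and>
            cyclically_monotone a1 a2 c ((\<lambda>\<pi>. (distr \<pi> borel fst, distr \<pi> borel snd)) ` F) \<and>
            (\<exists>\<phi>1. OT_concave a1 a2 c \<phi>1 \<and> F \<subseteq> total_superdiff a1 a2 c \<phi>1)) \<and>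
         (\<forall>G. cyclically_monotone a1 a2 c G \<longrightarrow>
            totally_cyclically_monotone a1 a2 c
              {\<pi> \<in> probs_fin_prod a1 a2.
                 \<pi> \<in> optimal_couplings c (distr \<pi> borel fst) (distr \<pi> borel snd) \<and>
                 (distr \<pi> borel fst, distr \<pi> borel snd) \<in> G})"
proof -
  interpret transport a1 a2 c
    by unfold_locales (use assms in auto)
  show ?thesis
    using optimal_of_totally_cyclically_monotone cyclically_monotone_marginals
      concave_potential_exists[OF _ assms(2,4)] totally_cyclically_monotone_optimal
    by (intro conjI allI impI ballI) simp_all
qed

end
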